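(* The sorting algorithm MergeInsertion needs $n\log n - c(n)\cdot n + O(\log n)$ comparisons on average to sort $n$ elements, where $c(n)\ge 1.3999$.
   Context: All logarithms are to base 2; the average is over the uniform distribution on all orderings of $n$ pairwise distinct elements, counting element comparisons. MergeInsertion (Ford–Johnson) on $n$ elements: (1) Group the elements into $\lfloor n/2\rfloor$ pairs and compare within each pair (one comparison per pair), calling the larger element of the $i$-th pair $a_i$ and the smaller $b_i$; if $n$ is odd, one element $b$ remains unpaired. (2) Sort the elements $a_i$ recursively with MergeInsertion; relabel so that $a_1<a_2<\dots<a_{\lfloor n/2\rfloor}$ and $b_i$ is the partner of $a_i$ (and the unpaired element, if any, is $b_{\lceil n/2\rceil}$). (3) The main chain is $b_1<a_1<\dots<a_{\lfloor n/2\rfloor}$; insert the remaining $b_i$ into the main chain by binary insertion, where $b_i$ ($i\le\lfloor n/2\rfloor$) is inserted among the main-chain elements smaller than $a_i$ (the unpaired element among all), in the order $b_3,b_2;\ b_5,b_4;\ b_{11},\dots,b_6;\ \dots;\ b_{t_k},b_{t_k-1},\dots,b_{t_{k-1}+1};\dots$, where $t_k=(2^{k+1}+(-1)^k)/3$ (indices exceeding the number of $b$'s are skipped, the last group being inserted starting from the largest existing index). In the analyzed (basic) variant, each element of the $k$-th group $b_{t_k},\dots,b_{t_{k-1}+1}$ is inserted by binary search over a range of at most $2^k-1$ main-chain elements, so using at most $k$ comparisons. *)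

theory Defs
  imports Complex_Main "HOL-Combinatorics.Multiset_Permutations" "HOL-Library.Landau_Symbols"
begin

function binsert :: "'a::linorder \<Rightarrow> 'a list \<Rightarrow> 'a list \<times> nat" where
  "binsert x ys =
     (if ys = [] then ([x], 0)
      else (let j = length ys div 2 in
            if x < ys ! j then
              (case binsert x (take j ys) of (zs, c) \<Rightarrow> (zs @ drop j ys, Suc c))
            else
              (case binsert x (drop (Suc j) ys) of (zs, c) \<Rightarrow> (take (Suc j) ys @ zs, Suc c))))"
  by pat_completeness auto
termination
  by (relation "measure (\<lambda>(x, ys). length ys)") auto

definition tJ :: "nat \<Rightarrow> nat" where
  "tJ k = (if even k then (2 ^ (k + 1) + 1) div 3 else (2 ^ (k + 1) - 1) div 3)"

text \<open>Order in which b_2, ..., b_N are inserted: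
  b_3, b_2; b_5, b_4; b_11, ..., b_6; ...; indices exceeding N are skipped.\<close>
definition ins_order :: "nat \<Rightarrow> nat list" where
  "ins_order N = concat (map (\<lambda>k. rev [tJ (k - 1) + 1 ..< Suc (min (tJ k) N)]) [2 ..< N + 2])"

function merge_insertion :: "'a::linorder list \<Rightarrow> 'a list \<times> nat" where
  "merge_insertion xs =
    (if length xs \<le> 1 then (xs, 0) else
     (let m = length xs div 2;
          prs = map (\<lambda>i. (max (xs ! (2 * i)) (xs ! (2 * i + 1)),
                           min (xs ! (2 * i)) (xs ! (2 * i + 1)))) [0 ..< m]
      in case merge_insertion (map fst prs) of (as, c_rec) \<Rightarrow>
       (let bs = map (\<lambda>a. the (map_of prs a)) as;
            B = bs @ (if odd (length xs) then [last xs] else []);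
            step = (\<lambda>(ch, c) i.
                      let rng = (if i \<le> m then takeWhile (\<lambda>z. z \<noteq> as ! (i - 1)) ch
                                 else ch)
                      in case binsert (B ! (i - 1)) rng of
                           (r, c') \<Rightarrow> (r @ drop (length rng) ch, c + c'));
            res = foldl step (hd B # as, 0) (ins_order (length B))
        in (fst res, m + c_rec + snd res))))"
  by pat_completeness auto
termination
  by (relation "measure length") auto

definition avg_comparisons_MI :: "nat \<Rightarrow> real" where
  "avg_comparisons_MI n =
     (\<Sum>xs\<in>permutations_of_set {0..<n}. real (snd (merge_insertion xs)))
       / real (card (permutations_of_set {0..<(n::nat)}))"

end

theory Submission
  imports Defs "HOL-Analysis.Harmonic_Numbers" "HOL-Real_Asymp.Real_Asymp"
begin

text \<open>
  Only an upper bound on the average is needed, since \<open>c\<close> may absorb any further saving. Let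
  \<open>N\<close> be the number of \<open>b\<close>'s, \<open>k\<close> the index of the last group and \<open>t = tJ (k - 1)\<close>. An element
  of an earlier group \<open>j\<close> costs at most \<open>j\<close> comparisons. An element of the last group is inserted
  into a chain with \<open>s \<le> N + t \<le> 2 ^ k\<close> gaps. Exchanging its value with that of its predecessor in
  the chain shows that, for fixed \<open>s\<close>, its gap distribution is decreasing from left to right. The
  \<open>2 ^ k - s\<close> gaps which cost only \<open>k - 1\<close> comparisons are spread evenly over the chain up to an
  error of \<open>k\<close>, so Abel summation bounds the expected cost by \<open>k + 1 - 2 ^ k / s\<close> plus \<open>k\<close> times
  the probability of the leftmost gap, and exchanging values with \<open>b\<^sub>1, ..., b\<^sub>t\<close> shows that the
  latter is at most \<open>1 / t\<close>. Summing over one insertion phase gives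
  \<open>N log N + N - (log z + 12 / (3 z + 2) - 1) N + O(log\<^sup>2 N)\<close> with \<open>z = 2 N / 2 ^ k\<close>, and the
  parenthesis is at least 1.39995. The surplus over 1.3999 swallows all lower order terms.
\<close>

hide_const (open) Finite_Cartesian_Product.transpose
hide_fact (open) Finite_Cartesian_Product.transpose_def

subsection \<open>Cost of a binary insertion\<close>

lemma halving_induct [consumes 2, case_names one add]:
  fixes k s :: nat
  assumes "2 ^ k \<le> 2 * s" and "s \<le> 2 ^ k"
    and one: "\<And>k. k \<le> 1 \<Longrightarrow> P k 1"
    and add: "\<And>k l r. \<lbrakk>2 ^ k \<le> 2 * l; l \<le> 2 ^ k; 2 ^ k \<le> 2 * r; r \<le> 2 ^ k; r \<le> l; l \<le> Suc r;
      P k l; P k r\<rbrakk> \<Longrightarrow> P (Suc k) (l + r)"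
  shows "P k s"
  using assms(1,2)
proof (induction k arbitrary: s)
  case 0
  then have "s = 1" by auto
  then show ?case using one[of 0] by simp
next
  case (Suc k)
  show ?case
  proof (cases "s = 1")
    case True
    then have "2 ^ k \<le> (1::nat)" using Suc.prems by simp
    with less_exp[of k] have "k = 0" by linarith
    then show ?thesis using one[of 1] True by simp
  next
    case False
    then have "s \<ge> 2" using Suc.prems by (cases s) auto
    define l r where "l = (s + 1) div 2" and "r = s div 2"
    have halves: "2 ^ k \<le> 2 * l" "l \<le> 2 ^ k" "2 ^ k \<le> 2 * r" "r \<le> 2 ^ k"
      using Suc.prems \<open>s \<ge> 2\<close> by (cases k; auto simp: l_def r_def)+
    have "P (Suc k) (l + r)"
      using halves by (intro add Suc.IH) (auto simp: l_def r_def)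
    moreover have "l + r = s" by (simp add: l_def r_def)
    ultimately show ?thesis by simp
  qed
qed

function binsert_cost :: "nat \<Rightarrow> nat \<Rightarrow> nat" where
  "binsert_cost s p =
     (if s \<le> 1 then 0
      else Suc (if p < (s + 1) div 2 then binsert_cost ((s + 1) div 2) p
                else binsert_cost (s div 2) (p - (s + 1) div 2)))"
  by pat_completeness auto
termination
  by (relation "measure fst") auto

declare binsert_cost.simps [simp del] binsert.simps [simp del]

lemma binsert_cost_one [simp]: "binsert_cost (Suc 0) p = 0"
  by (simp add: binsert_cost.simps)

lemma binsert_cost_left:
  assumes "r \<le> l" "l \<le> Suc r" "r > 0" "p < l"
  shows "binsert_cost (l + r) p = Suc (binsert_cost l p)"
proof -
  have "(l + r + 1) div 2 = l" using assms by simp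
  then show ?thesis using assms by (subst binsert_cost.simps) simp
qed

lemma binsert_cost_right:
  assumes "r \<le> l" "l \<le> Suc r" "r > 0"
  shows "binsert_cost (l + r) (l + p) = Suc (binsert_cost r p)"
proof -
  have "(l + r + 1) div 2 = l" "(l + r) div 2 = r" using assms by simp_all
  then show ?thesis using assms by (subst binsert_cost.simps) simp
qed

lemma binsert_cost_le: "s \<le> 2 ^ k \<Longrightarrow> binsert_cost s p \<le> k"
proof (induction k arbitrary: s p)
  case 0
  then show ?case by (simp add: binsert_cost.simps)
next
  case (Suc k)
  have "(s + 1) div 2 \<le> 2 ^ k" "s div 2 \<le> 2 ^ k" using Suc.prems by auto
  then show ?case
    using Suc.IH by (subst binsert_cost.simps) auto
qed

lemma sum_binsert_cost_left:
  assumes "r \<le> l" "l \<le> Suc r" "r > 0" "q \<le> l"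
  shows "(\<Sum>p<q. real (binsert_cost (l + r) p)) = real q + (\<Sum>p<q. real (binsert_cost l p))"
  using assms by (simp add: binsert_cost_left sum.distrib)

lemma sum_binsert_cost_right:
  assumes "r \<le> l" "l \<le> Suc r" "r > 0"
  shows "(\<Sum>p<l + q. real (binsert_cost (l + r) p)) =
    real (l + q) + (\<Sum>p<l. real (binsert_cost l p)) + (\<Sum>p<q. real (binsert_cost r p))"
proof (induction q)
  case 0
  then show ?case using sum_binsert_cost_left[OF assms] by simp
next
  case (Suc q)
  then show ?case using binsert_cost_right[OF assms, of q] by simp
qed

definition mean_binsert_cost :: "nat \<Rightarrow> nat \<Rightarrow> real" where
  "mean_binsert_cost k s = real k + 1 - 2 ^ k / real s"

lemma mean_binsert_cost_mono: "0 < s \<Longrightarrow> s \<le> S \<Longrightarrow> mean_binsert_cost k s \<le> mean_binsert_cost k S"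
  unfolding mean_binsert_cost_def by (intro diff_left_mono divide_left_mono) auto

lemma sum_binsert_cost:
  assumes "2 ^ k \<le> 2 * s" "s \<le> 2 ^ k"
  shows "(\<Sum>p<s. real (binsert_cost s p)) = real s * mean_binsert_cost k s"
  using assms
proof (induction k s rule: halving_induct)
  case (one k)
  then have "k = 0 \<or> k = 1" by auto
  then show ?case by (auto simp: mean_binsert_cost_def)
next
  case (add k l r)
  have "r > 0" using add.hyps by (cases r) auto
  then show ?case
    using add by (simp add: sum_binsert_cost_right mean_binsert_cost_def right_diff_distrib)
      (simp add: algebra_simps)
qed

lemma mult_mean_binsert_cost_half_le:
  fixes y :: real
  assumes "2 ^ k \<le> s" "0 < x" "\<bar>real s - 2 * real x\<bar> \<le> 1" "\<bar>y\<bar> \<le> real x"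
  shows "y * (1 + mean_binsert_cost k x - mean_binsert_cost (Suc k) s) \<le> 1"
proof -
  define K :: real where "K = 2 ^ k"
  define d where "d = 2 * K / real s - K / real x"
  have K: "0 < K" "K \<le> real s" using assms(1) by (simp_all add: K_def)
  have "y * d \<le> \<bar>y\<bar> * \<bar>d\<bar>" by (metis abs_ge_self abs_mult)
  also have "\<dots> \<le> real x * \<bar>d\<bar>" using assms(4) by (intro mult_right_mono) auto
  also have "\<dots> = \<bar>real x * d\<bar>" by (simp add: abs_mult)
  also have "real x * d = K / real s * (2 * real x - real s)"
    using assms(2) K by (simp add: d_def field_simps)
  also have "\<bar>\<dots>\<bar> = K / real s * \<bar>real s - 2 * real x\<bar>"
    using K by (simp add: abs_mult abs_minus_commute)
  also have "\<dots> \<le> 1 * 1" using assms(3) K by (intro mult_mono) auto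
  finally show ?thesis by (simp add: mean_binsert_cost_def d_def K_def)
qed

lemma sum_binsert_cost_prefix_left_le:
  assumes "r \<le> l" "l \<le> Suc r" "r > 0" "2 ^ k \<le> l + r" "q \<le> l"
    and left: "(\<Sum>p<q. real (binsert_cost l p)) \<le> real q * mean_binsert_cost k l + real k"
  shows "(\<Sum>p<q. real (binsert_cost (l + r) p)) \<le>
    real q * mean_binsert_cost (Suc k) (l + r) + real (Suc k)"
proof -
  have "(\<Sum>p<q. real (binsert_cost (l + r) p)) = real q + (\<Sum>p<q. real (binsert_cost l p))"
    using assms by (simp add: sum_binsert_cost_left)
  moreover have
    "real q * (1 + mean_binsert_cost k l - mean_binsert_cost (Suc k) (l + r)) \<le> 1"
    using assms by (intro mult_mean_binsert_cost_half_le) auto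
  ultimately show ?thesis using left by (simp add: algebra_simps)
qed

lemma sum_binsert_cost_prefix_right_le:
  assumes r: "r \<le> l" "l \<le> Suc r" "r > 0" "2 ^ k \<le> 2 * r" and l: "l \<le> 2 ^ k" and "u \<le> r"
    and right: "(\<Sum>p<u. real (binsert_cost r p)) \<le> real u * mean_binsert_cost k r + real k"
  shows "(\<Sum>p<l + u. real (binsert_cost (l + r) p)) \<le>
    real (l + u) * mean_binsert_cost (Suc k) (l + r) + real (Suc k)"
proof -
  define M where "M = mean_binsert_cost (Suc k) (l + r)"
  have sum_l: "(\<Sum>p<l. real (binsert_cost l p)) = real l * mean_binsert_cost k l"
    using r l by (intro sum_binsert_cost) auto
  have "real (l + r) * M = (\<Sum>p<l + r. real (binsert_cost (l + r) p))"
    unfolding M_def using r l by (intro sum_binsert_cost[symmetric]) auto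
  also have "\<dots> = real (l + r) + real l * mean_binsert_cost k l + real r * mean_binsert_cost k r"
    using r l by (simp add: sum_binsert_cost_right sum_binsert_cost)
  finally have total: "real (l + r) * M =
      real (l + r) + real l * mean_binsert_cost k l + real r * mean_binsert_cost k r" .
  have "(\<Sum>p<l + u. real (binsert_cost (l + r) p)) \<le>
      real (l + u) + real l * mean_binsert_cost k l + (real u * mean_binsert_cost k r + real k)"
    using right by (simp add: sum_binsert_cost_right[OF r(1-3)] sum_l)
  also have "\<dots> = real (l + u) * M + real k + (real u - real r) * (1 + mean_binsert_cost k r - M)"
    using total by (simp add: algebra_simps)
  also have "(real u - real r) * (1 + mean_binsert_cost k r - M) \<le> 1"
    unfolding M_def using r \<open>u \<le> r\<close> by (intro mult_mean_binsert_cost_half_le) auto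
  finally show ?thesis by (simp add: M_def)
qed

lemma sum_binsert_cost_prefix_le:
  assumes "2 ^ k \<le> 2 * s" "s \<le> 2 ^ k" "q \<le> s"
  shows "(\<Sum>p<q. real (binsert_cost s p)) \<le> real q * mean_binsert_cost k s + real k"
  using assms
proof (induction k s arbitrary: q rule: halving_induct)
  case (one k)
  then have "k = 0 \<or> k = 1" by auto
  then show ?case using \<open>q \<le> 1\<close> by (auto simp: le_Suc_eq mean_binsert_cost_def)
next
  case (add k l r)
  have "r > 0" using add.hyps by (cases r) auto
  show ?case
  proof (cases "q \<le> l")
    case True
    then show ?thesis
      using add.hyps \<open>r > 0\<close> by (intro sum_binsert_cost_prefix_left_le add.IH) auto
  next
    case False
    then obtain u where q: "q = l + u" "u \<le> r"
      using add.prems by (auto simp: not_le less_iff_Suc_add)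
    show ?thesis
      unfolding q(1) using add.hyps \<open>r > 0\<close> q(2)
      by (intro sum_binsert_cost_prefix_right_le add.IH) auto
  qed
qed

lemma sum_antitone_mult_le:
  fixes w c :: "nat \<Rightarrow> 'a::linordered_idom"
  assumes antitone: "\<And>p. Suc p < n \<Longrightarrow> w (Suc p) \<le> w p"
    and nonneg: "\<And>p. p < n \<Longrightarrow> w p \<ge> 0"
    and prefix: "\<And>q. q \<le> n \<Longrightarrow> (\<Sum>p<q. c p) \<le> E"
    and "n > 0"
  shows "(\<Sum>p<n. w p * c p) \<le> E * w 0"
proof -
  have "(\<Sum>p<Suc i. w p * c p) \<le> w i * (\<Sum>p<Suc i. c p) + E * (w 0 - w i)" if "i < n" for i
    using that
  proof (induction i)
    case (Suc i)
    have "(w i - w (Suc i)) * (\<Sum>p<Suc i. c p) \<le> (w i - w (Suc i)) * E"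
      using Suc.prems antitone[of i] prefix[of "Suc i"] by (intro mult_left_mono) auto
    then show ?case using Suc by (simp add: algebra_simps)
  qed simp
  from this[of "n - 1"] have "(\<Sum>p<n. w p * c p)
      \<le> w (n - 1) * (\<Sum>p<n. c p) + E * (w 0 - w (n - 1))"
    using \<open>n > 0\<close> by simp
  also have "\<dots> \<le> w (n - 1) * E + E * (w 0 - w (n - 1))"
    using nonneg prefix \<open>n > 0\<close> by (intro add_right_mono mult_left_mono) auto
  finally show ?thesis by (simp add: algebra_simps)
qed

lemma sum_antitone_mult_binsert_cost_le:
  fixes w :: "nat \<Rightarrow> real"
  assumes "\<And>p. Suc p < s \<Longrightarrow> w (Suc p) \<le> w p" and "\<And>p. p < s \<Longrightarrow> w p \<ge> 0"
    and s: "2 ^ k \<le> 2 * s" "s \<le> 2 ^ k"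
  shows "(\<Sum>p<s. w p * real (binsert_cost s p))
    \<le> mean_binsert_cost k s * (\<Sum>p<s. w p) + real k * w 0"
proof -
  have "s > 0" using s by (cases s) auto
  have "(\<Sum>p<q. real (binsert_cost s p) - mean_binsert_cost k s) \<le> real k" if "q \<le> s" for q
    using sum_binsert_cost_prefix_le[OF s that] by (simp add: sum_subtractf)
  then have "(\<Sum>p<s. w p * (real (binsert_cost s p) - mean_binsert_cost k s)) \<le> real k * w 0"
    using assms \<open>s > 0\<close> by (intro sum_antitone_mult_le) auto
  then show ?thesis
    by (simp add: right_diff_distrib sum_subtractf sum_distrib_left mult.commute)
qed

lemma bisect_induct [case_names Nil append]:
  assumes "P []"
    and append: "\<And>L y R. \<lbrakk>length R \<le> length L; length L \<le> Suc (length R); P L; P R\<rbrakk> \<Longrightarrow> P (L @ y # R)"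
  shows "P ys"
proof (induction ys rule: length_induct)
  case (1 ys)
  show ?case
  proof (cases "ys = []")
    case False
    define j where "j = length ys div 2"
    have "j < length ys" using False by (simp add: j_def)
    then have "P (take j ys @ ys ! j # drop (Suc j) ys)"
      using 1 by (intro append) (auto simp: j_def)
    then show ?thesis using \<open>j < length ys\<close> by (simp flip: id_take_nth_drop)
  qed (simp add: assms(1))
qed

lemma binsert_append_Cons:
  assumes "length R \<le> length L" "length L \<le> Suc (length R)"
  shows "binsert x (L @ y # R) =
    (if x < y then (fst (binsert x L) @ y # R, Suc (snd (binsert x L)))
     else (L @ y # fst (binsert x R), Suc (snd (binsert x R))))"
proof -
  have "length (L @ y # R) div 2 = length L" using assms by simp
  then show ?thesis by (subst binsert.simps) (simp add: Let_def split: prod.split)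
qed

lemma insort_append_Cons:
  assumes "sorted (L @ y # R)"
  shows "insort x (L @ y # R) = (if x < y then insort x L @ y # R else L @ y # insort x R)"
proof -
  have "insort x (L @ y # R) = sort (x # L @ y # R)"
    using assms by (simp add: sorted_sort_id)
  also have "\<dots> = (if x < y then insort x L @ y # R else L @ y # insort x R)"
    using assms
    by (intro properties_for_sort) (auto simp: sorted_append set_insort_key sorted_insort)
  finally show ?thesis .
qed

lemma fst_binsert: "sorted ys \<Longrightarrow> fst (binsert x ys) = insort x ys"
proof (induction ys rule: bisect_induct)
  case Nil
  then show ?case by (simp add: binsert.simps)
next
  case (append L y R)
  then have "sorted L" "sorted R" by (simp_all add: sorted_append)
  then show ?case using append by (simp add: binsert_append_Cons insort_append_Cons)
qed

lemma snd_binsert: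
  "sorted ys \<Longrightarrow> snd (binsert x ys) = binsert_cost (Suc (length ys)) (length (filter (\<lambda>z. z \<le> x) ys))"
proof (induction ys rule: bisect_induct)
  case Nil
  then show ?case by (simp add: binsert.simps)
next
  case (append L y R)
  then have sorted: "sorted L" "sorted R" "\<forall>z\<in>set L. z \<le> y" "\<forall>z\<in>set R. y \<le> z"
    by (auto simp: sorted_append)
  have gaps: "Suc (length (L @ y # R)) = Suc (length L) + Suc (length R)" by simp
  show ?case
  proof (cases "x < y")
    case True
    have "filter (\<lambda>z. z \<le> x) (y # R) = []"
      using True sorted by (auto simp: filter_empty_conv)
    then have "length (filter (\<lambda>z. z \<le> x) (L @ y # R)) = length (filter (\<lambda>z. z \<le> x) L)"
      by (simp only: filter_append append_Nil2)
    moreover have "\<dots> < Suc (length L)" by (simp add: le_imp_less_Suc)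
    ultimately show ?thesis
      unfolding gaps using append True sorted
      by (simp only: binsert_append_Cons binsert_cost_left) simp
  next
    case False
    then have "filter (\<lambda>z. z \<le> x) L = L" using sorted by (auto simp: filter_id_conv)
    then have "length (filter (\<lambda>z. z \<le> x) (L @ y # R)) =
        Suc (length L) + length (filter (\<lambda>z. z \<le> x) R)"
      using False by simp
    then show ?thesis
      unfolding gaps using append False sorted
      by (simp only: binsert_append_Cons binsert_cost_right) (simp add: binsert_cost_right)
  qed
qed

subsection \<open>The insertion phase\<close>

text \<open>Indices start at 1, as in \<open>ins_order\<close>; \<open>P\<close> is the set of indices already inserted, and
  \<open>i > length as\<close> only occurs for the unpaired element.\<close>
definition main_chain :: "'a list \<Rightarrow> 'a list \<Rightarrow> nat set \<Rightarrow> 'a set" where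
  "main_chain as bs P = set as \<union> (\<lambda>l. bs ! (l - 1)) ` P"

definition ins_range :: "'a::linorder list \<Rightarrow> 'a list \<Rightarrow> nat set \<Rightarrow> nat \<Rightarrow> 'a set" where
  "ins_range as bs P i = {z \<in> main_chain as bs P. i \<le> length as \<longrightarrow> z < as ! (i - 1)}"

definition ins_rank :: "'a::linorder list \<Rightarrow> 'a list \<Rightarrow> nat set \<Rightarrow> nat \<Rightarrow> nat" where
  "ins_rank as bs P i = card {z \<in> ins_range as bs P i. z < bs ! (i - 1)}"

definition ins_cost :: "'a::linorder list \<Rightarrow> 'a list \<Rightarrow> nat set \<Rightarrow> nat \<Rightarrow> nat" where
  "ins_cost as bs P i = binsert_cost (Suc (card (ins_range as bs P i))) (ins_rank as bs P i)"

definition ins_step :: "'a::linorder list \<Rightarrow> 'a list \<Rightarrow> 'a list \<times> nat \<Rightarrow> nat \<Rightarrow> 'a list \<times> nat" where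
  "ins_step as bs = (\<lambda>(ch, c) i.
     let rng = (if i \<le> length as then takeWhile (\<lambda>z. z \<noteq> as ! (i - 1)) ch else ch)
     in case binsert (bs ! (i - 1)) rng of (r, c') \<Rightarrow> (r @ drop (length rng) ch, c + c'))"

lemma finite_main_chain [simp]: "finite P \<Longrightarrow> finite (main_chain as bs P)"
  by (simp add: main_chain_def)

lemma finite_ins_range [simp]: "finite P \<Longrightarrow> finite (ins_range as bs P i)"
  by (simp add: ins_range_def)

lemma main_chain_insert:
  "main_chain as bs (insert i P) = insert (bs ! (i - 1)) (main_chain as bs P)"
  by (simp add: main_chain_def)

lemma image_nth_pred: "t \<le> length xs \<Longrightarrow> (\<lambda>l. xs ! (l - 1)) ` {1..t} = set (take t xs)"
  using image_image[of "\<lambda>l. xs ! (l - 1)" Suc "{0..<t}"]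
  by (simp add: nth_image image_Suc_atLeastLessThan atLeastLessThanSuc_atLeastAtMost)

lemma strict_sorted_eq_sorted_list_of_set:
  "sorted_wrt (<) xs \<Longrightarrow> set xs = A \<Longrightarrow> xs = sorted_list_of_set A"
  by (metis sorted_list_of_set.idem_if_sorted_distinct strict_sorted_iff)

lemma sorted_list_of_set_split:
  fixes X :: "'a::linorder set"
  assumes "finite X"
  shows "sorted_list_of_set X =
    sorted_list_of_set {z \<in> X. z < a} @ sorted_list_of_set {z \<in> X. a \<le> z}"
  using assms
  by (intro strict_sorted_eq_sorted_list_of_set[symmetric])
    (auto simp: sorted_wrt_append intro: order.strict_trans2)

lemma takeWhile_sorted_list_of_set:
  fixes X :: "'a::linorder set"
  assumes "finite X" "a \<in> X"
  shows "takeWhile (\<lambda>z. z \<noteq> a) (sorted_list_of_set X) = sorted_list_of_set {z \<in> X. z < a}"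
proof -
  have "sorted_list_of_set {z \<in> X. a \<le> z} = a # sorted_list_of_set {z \<in> X. a < z}"
    using assms by (intro strict_sorted_eq_sorted_list_of_set[symmetric]) auto
  then show ?thesis
    using assms by (subst sorted_list_of_set_split[of X a]) (auto simp: takeWhile_append)
qed

lemma set_take_sorted_wrt:
  assumes "sorted_wrt r xs" "asymp r" "q < length xs"
  shows "set (take q xs) = {x \<in> set xs. r x (xs ! q)}"
proof -
  have "sorted_wrt r (take q xs @ xs ! q # drop (Suc q) xs)"
    using assms by (simp flip: id_take_nth_drop)
  then have "\<forall>x\<in>set (take q xs). r x (xs ! q)" "\<forall>x\<in>set (drop (Suc q) xs). r (xs ! q) x"
    by (auto simp: sorted_wrt_append)
  moreover have "set xs = set (take q xs) \<union> insert (xs ! q) (set (drop (Suc q) xs))"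
    using arg_cong[OF id_take_nth_drop[OF assms(3)], of set] by simp
  ultimately show ?thesis using assms(2) by (auto dest: asympD)
qed

lemma sorted_wrt_asymp_imp_distinct: "sorted_wrt r xs \<Longrightarrow> asymp r \<Longrightarrow> distinct xs"
  by (induction xs) (auto dest: asympD)

lemma binsert_sorted_list_of_set:
  assumes "finite X" "x \<notin> X"
  shows "binsert x (sorted_list_of_set X) =
    (sorted_list_of_set (insert x X), binsert_cost (Suc (card X)) (card {z \<in> X. z < x}))"
proof (rule prod_eqI)
  have "{z \<in> X. z \<le> x} = {z \<in> X. z < x}" using assms(2) by (auto simp: order_le_less)
  then have "length (filter (\<lambda>z. z \<le> x) (sorted_list_of_set X)) = card {z \<in> X. z < x}"
    using assms(1) by (simp add: distinct_length_filter Int_def conj_commute)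
  then show "snd (binsert x (sorted_list_of_set X)) =
      snd (sorted_list_of_set (insert x X), binsert_cost (Suc (card X)) (card {z \<in> X. z < x}))"
    using assms(1) by (simp add: snd_binsert)
qed (use assms in \<open>simp add: fst_binsert sorted_list_of_set_insert\<close>)

locale sorted_pairing =
  fixes as bs :: "'a::linorder list"
  assumes strict_sorted_as: "sorted_wrt (<) as"
    and distinct_append: "distinct (as @ bs)"
    and nth_bs_less: "i < length as \<Longrightarrow> bs ! i < as ! i"
    and length_as_le: "length as \<le> length bs"
    and length_bs_le: "length bs \<le> Suc (length as)"
begin

lemma nth_pred_bs_eq_iff:
  "l \<in> {1..length bs} \<Longrightarrow> i \<in> {1..length bs} \<Longrightarrow> bs ! (l - 1) = bs ! (i - 1) \<longleftrightarrow> l = i"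
  using distinct_append by (subst nth_eq_iff_index_eq) auto

lemma nth_bs_notin_as: "i < length bs \<Longrightarrow> bs ! i \<notin> set as"
  using distinct_append by fastforce

lemma set_take_as:
  assumes "j \<in> {1..length bs}"
  shows "set (take (j - 1) as) = {z \<in> set as. j \<le> length as \<longrightarrow> z < as ! (j - 1)}"
proof (cases "j \<le> length as")
  case True
  then show ?thesis
    using assms set_take_sorted_wrt[OF strict_sorted_as, of "j - 1"] by auto
next
  case False
  then show ?thesis using length_bs_le assms by auto
qed

end

locale insertion = sorted_pairing as bs for as bs :: "'a::linorder list" +
  fixes P :: "nat set" and j :: nat
  assumes index_j: "j \<in> {1..length bs}"
    and inserted_subset: "P \<subseteq> {1..length bs}"
    and j_notin: "j \<notin> P"
begin

abbreviation "new \<equiv> bs ! (j - 1)"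
abbreviation "range_j \<equiv> ins_range as bs P j"

lemma finite_inserted: "finite P"
  using inserted_subset finite_subset by blast

lemma pred_inserted_less: "l \<in> P \<Longrightarrow> l - 1 < length bs"
  using inserted_subset by (metis atLeastAtMost_iff diff_less less_le_trans subsetD zero_less_one)

lemma new_mem: "new \<in> set bs"
  using index_j by (intro nth_mem) auto

lemma new_notin_as: "new \<notin> set as"
  using index_j by (intro nth_bs_notin_as) auto

lemma new_notin_main_chain: "new \<notin> main_chain as bs P"
proof
  assume "new \<in> main_chain as bs P"
  then obtain l where "l \<in> P" "new = bs ! (l - 1)"
    using new_notin_as by (auto simp: main_chain_def)
  then show False
    using nth_pred_bs_eq_iff[of j l] index_j inserted_subset j_notin by auto
qed

lemma new_notin_range: "new \<notin> range_j"
  using new_notin_main_chain by (simp add: ins_range_def)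

lemma new_less: "j \<le> length as \<Longrightarrow> new < as ! (j - 1)"
  using index_j by (intro nth_bs_less) auto

lemma main_chain_subset: "main_chain as bs P \<subseteq> set as \<union> set bs"
proof -
  have "(\<lambda>l. bs ! (l - 1)) ` P \<subseteq> (\<lambda>l. bs ! (l - 1)) ` {1..length bs}"
    using inserted_subset by (rule image_mono)
  also have "\<dots> = set bs" using image_nth_pred[of "length bs" bs] by simp
  finally show ?thesis by (auto simp: main_chain_def)
qed

lemma range_subset: "range_j \<subseteq> set as \<union> set bs"
  using main_chain_subset by (auto simp: ins_range_def)

lemma earlier_mem_range:
  assumes "l \<in> P" "l < j"
  shows "bs ! (l - 1) \<in> range_j"
proof -
  have "bs ! (l - 1) < as ! (j - 1)" if "j \<le> length as"
  proof -
    have "l - 1 < j - 1" "j - 1 < length as" using assms that inserted_subset index_j by auto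
    then have "bs ! (l - 1) < as ! (l - 1)" "as ! (l - 1) < as ! (j - 1)"
      using nth_bs_less strict_sorted_as by (auto simp: sorted_wrt_iff_nth_less)
    then show ?thesis by (rule less_trans)
  qed
  then show ?thesis using assms by (auto simp: ins_range_def main_chain_def)
qed

lemma card_range_le: "card range_j \<le> j - 1 + card P"
proof -
  have "range_j \<subseteq> set (take (j - 1) as) \<union> (\<lambda>l. bs ! (l - 1)) ` P"
    unfolding set_take_as[OF index_j] by (auto simp: ins_range_def main_chain_def)
  then have "card range_j \<le> card (set (take (j - 1) as) \<union> (\<lambda>l. bs ! (l - 1)) ` P)"
    using finite_inserted by (intro card_mono) auto
  also have "\<dots> \<le> card (set (take (j - 1) as)) + card ((\<lambda>l. bs ! (l - 1)) ` P)"
    by (rule card_Un_le)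
  also have "\<dots> \<le> j - 1 + card P"
    using card_length[of "take (j - 1) as"] card_image_le[OF finite_inserted]
    by (intro add_mono) auto
  finally show ?thesis .
qed

lemma card_range_ge:
  assumes "{1..t} \<subseteq> P" "t < j"
  shows "j - 1 + t \<le> card range_j"
proof -
  have "j - 1 \<le> length as" "t \<le> length bs" using index_j length_bs_le assms(2) by auto
  then have "j - 1 + t = length (take (j - 1) as @ take t bs)" by simp
  also have "\<dots> = card (set (take (j - 1) as @ take t bs))"
    using distinct_append by (intro distinct_card[symmetric]) (auto dest: in_set_takeD)
  also have "\<dots> \<le> card range_j"
  proof (rule card_mono)
    have "set (take (j - 1) as) \<subseteq> range_j"
      unfolding set_take_as[OF index_j] by (auto simp: ins_range_def main_chain_def)
    moreover have "set (take t bs) \<subseteq> range_j"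
      unfolding image_nth_pred[OF \<open>t \<le> length bs\<close>, symmetric]
      using assms earlier_mem_range by auto
    ultimately show "set (take (j - 1) as @ take t bs) \<subseteq> range_j" by simp
  qed (use finite_inserted in simp)
  finally show ?thesis .
qed

lemma takeWhile_main_chain:
  "(if j \<le> length as then takeWhile (\<lambda>z. z \<noteq> as ! (j - 1)) (sorted_list_of_set (main_chain as bs P))
    else sorted_list_of_set (main_chain as bs P)) = sorted_list_of_set range_j"
proof (cases "j \<le> length as")
  case True
  then have "as ! (j - 1) \<in> main_chain as bs P" using index_j by (auto simp: main_chain_def)
  then show ?thesis
    using True finite_inserted by (simp add: takeWhile_sorted_list_of_set ins_range_def)
qed (simp add: ins_range_def)

lemma insert_range_append_rest:
  "sorted_list_of_set (insert new range_j) @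
     drop (card range_j) (sorted_list_of_set (main_chain as bs P)) =
   sorted_list_of_set (insert new (main_chain as bs P))"
proof (cases "j \<le> length as")
  case True
  define a where "a = as ! (j - 1)"
  define X where "X = main_chain as bs P"
  have "finite X" using finite_inserted by (simp add: X_def)
  have range: "range_j = {z \<in> X. z < a}" using True by (simp add: ins_range_def X_def a_def)
  have "new < a" using new_less True by (simp add: a_def)
  then have parts: "{z \<in> insert new X. z < a} = insert new range_j"
    "{z \<in> insert new X. a \<le> z} = {z \<in> X. a \<le> z}"
    unfolding range by auto
  have "drop (card range_j) (sorted_list_of_set X) = sorted_list_of_set {z \<in> X. a \<le> z}"
    using \<open>finite X\<close> by (subst sorted_list_of_set_split[of X a]) (simp_all add: range)
  then show ?thesis
    using sorted_list_of_set_split[of "insert new X" a] \<open>finite X\<close>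
    unfolding parts by (simp add: X_def)
next
  case False
  then have "range_j = main_chain as bs P" by (simp add: ins_range_def)
  then show ?thesis using finite_inserted by simp
qed

lemma ins_step_sorted:
  "ins_step as bs (sorted_list_of_set (main_chain as bs P), c) j =
    (sorted_list_of_set (main_chain as bs (insert j P)), c + ins_cost as bs P j)"
proof -
  have "binsert new (sorted_list_of_set range_j) =
      (sorted_list_of_set (insert new range_j), ins_cost as bs P j)"
    using finite_inserted new_notin_range
    by (simp add: binsert_sorted_list_of_set ins_cost_def ins_rank_def)
  then show ?thesis
    unfolding ins_step_def using finite_inserted
    by (simp only: prod.case takeWhile_main_chain Let_def main_chain_insert
        length_sorted_list_of_set insert_range_append_rest)
qed

end

lemma (in sorted_pairing) foldl_ins_step:
  assumes "as \<noteq> []" "set is \<subseteq> {2..length bs}" "distinct is"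
  shows "foldl (ins_step as bs) (hd bs # as, 0) is =
    (sorted_list_of_set (main_chain as bs (insert 1 (set is))),
     \<Sum>q<length is. ins_cost as bs (insert 1 (set (take q is))) (is ! q))"
  using assms(2,3)
proof (induction "is" rule: rev_induct)
  case Nil
  have "bs \<noteq> []" using length_as_le assms(1) by auto
  have "sorted_wrt (<) (hd bs # as)"
    using nth_bs_less[of 0] strict_sorted_as \<open>as \<noteq> []\<close> \<open>bs \<noteq> []\<close>
    by (cases as) (auto simp: hd_conv_nth)
  moreover have "set (hd bs # as) = main_chain as bs {1}"
    using \<open>bs \<noteq> []\<close> by (simp add: main_chain_def hd_conv_nth)
  ultimately have "hd bs # as = sorted_list_of_set (main_chain as bs {1})"
    by (rule strict_sorted_eq_sorted_list_of_set)
  then show ?case by simp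
next
  case (snoc i "is")
  interpret insertion as bs "insert 1 (set is)" i
    using snoc.prems by unfold_locales auto
  have "(\<Sum>q<length is. ins_cost as bs (insert 1 (set (take q (is @ [i])))) ((is @ [i]) ! q)) =
      (\<Sum>q<length is. ins_cost as bs (insert 1 (set (take q is))) (is ! q))"
    by (intro sum.cong) (auto simp: nth_append)
  then show ?case
    using snoc by (simp add: ins_step_sorted insert_commute del: One_nat_def)
qed

subsection \<open>The insertion order\<close>

lemma two_power_mod_3: "(2::nat) ^ Suc k mod 3 = (if even k then 2 else 1)"
proof (induction k)
  case (Suc k)
  have "(2::nat) ^ Suc (Suc k) mod 3 = (2 * (2 ^ Suc k mod 3)) mod 3"
    by (simp add: mod_mult_right_eq)
  then show ?case using Suc by simp
qed simp

lemma three_mult_tJ: "3 * tJ k = (if even k then 2 ^ Suc k + 1 else 2 ^ Suc k - 1)"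
proof -
  obtain q r where "(2::nat) ^ Suc k = 3 * q + r" "r = (if even k then 2 else 1)"
    using two_power_mod_3[of k] by (metis mult_div_mod_eq)
  then show ?thesis by (auto simp: tJ_def simp del: power_Suc)
qed

lemma tJ_Suc_add_tJ: "tJ (Suc k) + tJ k = 2 ^ Suc k"
proof -
  have "(1::nat) \<le> 2 ^ Suc k" by simp
  then have "3 * (tJ (Suc k) + tJ k) = 3 * 2 ^ Suc k"
    unfolding distrib_left three_mult_tJ by (cases "even k") auto
  then show ?thesis by simp
qed

lemma tJ_Suc: "tJ (Suc k) = (if even k then 2 * tJ k - 1 else 2 * tJ k + 1)"
proof -
  have "(1::nat) \<le> 2 ^ k" by simp
  then have "3 * tJ (Suc k) = 3 * (if even k then 2 * tJ k - 1 else 2 * tJ k + 1)"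
    using three_mult_tJ[of k] three_mult_tJ[of "Suc k"] by (cases "even k"; simp; linarith)
  then show ?thesis by simp
qed

lemma abs_three_mult_tJ_diff_le: "\<bar>3 * real (tJ k) - 2 ^ Suc k\<bar> \<le> 1"
proof -
  have "(1::nat) \<le> 2 ^ Suc k" by simp
  then have "3 * tJ k \<le> 2 ^ Suc k + 1" "2 ^ Suc k \<le> 3 * tJ k + 1"
    unfolding three_mult_tJ by auto
  then have "real (3 * tJ k) \<le> real (2 ^ Suc k + 1)" "real (2 ^ Suc k) \<le> real (3 * tJ k + 1)"
    by (simp_all only: of_nat_le_iff)
  then show ?thesis by auto
qed

lemma tJ_0 [simp]: "tJ 0 = 1" and tJ_1 [simp]: "tJ (Suc 0) = 1"
  by (auto simp: tJ_def)

lemma tJ_pos: "tJ k \<ge> 1"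
  by (induction k) (auto simp: tJ_Suc)

lemma mono_tJ: "mono tJ"
proof -
  have "tJ n \<le> tJ (Suc n)" for n using tJ_pos[of n] by (auto simp: tJ_Suc)
  then show ?thesis by (simp add: mono_iff_le_Suc)
qed

lemma tJ_ge: "tJ k \<ge> k"
proof (induction k)
  case (Suc k)
  have "tJ k = 1 \<and> k \<le> 1 \<or> tJ k \<ge> 2"
    using Suc tJ_pos[of k] by linarith
  then show ?case using Suc by (auto simp: tJ_Suc le_Suc_eq)
qed simp

definition ins_group :: "nat \<Rightarrow> nat" where
  "ins_group i = (LEAST k. i \<le> tJ k)"

lemma ins_group_le_iff: "ins_group i \<le> k \<longleftrightarrow> i \<le> tJ k"
proof
  have "i \<le> tJ (ins_group i)" unfolding ins_group_def by (rule LeastI[of _ i]) (rule tJ_ge)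
  then show "i \<le> tJ k" if "ins_group i \<le> k" using monoD[OF mono_tJ that] by simp
qed (simp add: ins_group_def Least_le)

lemma less_ins_group_iff: "k < ins_group i \<longleftrightarrow> tJ k < i"
  using ins_group_le_iff[of i k] by linarith

lemma le_tJ_ins_group: "i \<le> tJ (ins_group i)"
  by (simp flip: ins_group_le_iff)

lemma ins_group_eqI: "tJ (k - 1) < i \<Longrightarrow> i \<le> tJ k \<Longrightarrow> ins_group i = k"
  using ins_group_le_iff[of i k] less_ins_group_iff[of "k - 1" i] by linarith

lemma ins_group_1 [simp]: "ins_group (Suc 0) = 0"
  using ins_group_le_iff[of 1 0] by simp

lemma ins_group_ge_2: "i \<ge> 2 \<Longrightarrow> ins_group i \<ge> 2"
  using less_ins_group_iff[of 1 i] by simp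

lemma tJ_pred_ins_group_less: "i \<ge> 2 \<Longrightarrow> tJ (ins_group i - 1) < i"
  using less_ins_group_iff[of "ins_group i - 1" i] ins_group_ge_2[of i] by simp

definition precedes :: "nat \<Rightarrow> nat \<Rightarrow> bool" where
  "precedes l i \<longleftrightarrow> ins_group l < ins_group i \<or> ins_group l = ins_group i \<and> i < l"

definition ins_order_upto :: "nat \<Rightarrow> nat \<Rightarrow> nat list" where
  "ins_order_upto N K =
     concat (map (\<lambda>k. rev [tJ (k - 1) + 1 ..< Suc (min (tJ k) N)]) [2 ..< Suc K])"

lemma ins_order_eq_upto: "ins_order N = ins_order_upto N (N + 1)"
  by (simp add: ins_order_def ins_order_upto_def)

lemma ins_order_upto_1: "ins_order_upto N (Suc 0) = []"
  by (simp add: ins_order_upto_def)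

lemma ins_order_upto_Suc:
  "K \<ge> 1 \<Longrightarrow> ins_order_upto N (Suc K) =
    ins_order_upto N K @ rev [tJ K + 1 ..< Suc (min (tJ (Suc K)) N)]"
  by (simp add: ins_order_upto_def)

lemma set_ins_order_upto: "K \<ge> 1 \<Longrightarrow> set (ins_order_upto N K) = {2..min (tJ K) N}"
proof (induction K rule: dec_induct)
  case (step K)
  have "tJ K \<le> tJ (Suc K)" "tJ K \<ge> 1" using mono_tJ tJ_pos by (auto simp: mono_def)
  then show ?case
    unfolding ins_order_upto_Suc[OF step.hyps(1)] set_append step.IH set_rev set_upt by auto
qed (simp add: ins_order_upto_1)

lemma sorted_ins_order_upto: "K \<ge> 1 \<Longrightarrow> sorted_wrt precedes (ins_order_upto N K)"
proof (induction K rule: dec_induct)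
  case (step K)
  have last: "ins_group i = Suc K" if "i \<in> set [tJ K + 1 ..< Suc (min (tJ (Suc K)) N)]" for i
    using that by (intro ins_group_eqI) auto
  have "sorted_wrt precedes (rev [tJ K + 1 ..< Suc (min (tJ (Suc K)) N)])"
    unfolding sorted_wrt_rev
    by (rule sorted_wrt_mono_rel[OF _ sorted_wrt_upt]) (use last in \<open>auto simp: precedes_def\<close>)
  moreover have "precedes l i"
    if "l \<in> set (ins_order_upto N K)" "i \<in> set [tJ K + 1 ..< Suc (min (tJ (Suc K)) N)]" for l i
  proof -
    have "ins_group l \<le> K"
      using that(1) step.hyps by (simp add: set_ins_order_upto ins_group_le_iff)
    then show ?thesis using last[OF that(2)] by (simp add: precedes_def)
  qed
  ultimately show ?case
    using step.IH unfolding ins_order_upto_Suc[OF step.hyps(1)] sorted_wrt_append set_rev by blast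
qed (simp add: ins_order_upto_1)

lemma set_ins_order: "set (ins_order N) = {2..N}"
  using tJ_ge[of "N + 1"] by (simp add: ins_order_eq_upto set_ins_order_upto min_absorb2)

lemma sorted_ins_order: "sorted_wrt precedes (ins_order N)"
  by (simp add: ins_order_eq_upto sorted_ins_order_upto)

lemma asymp_precedes: "asymp precedes"
  by (rule asympI) (auto simp: precedes_def)

lemma distinct_ins_order: "distinct (ins_order N)"
  by (rule sorted_wrt_asymp_imp_distinct[OF sorted_ins_order asymp_precedes])

definition prior :: "nat \<Rightarrow> nat \<Rightarrow> nat set" where
  "prior N i = {l \<in> {1..N}. precedes l i}"

lemma insert_take_ins_order:
  assumes "q < length (ins_order N)"
  shows "insert 1 (set (take q (ins_order N))) = prior N (ins_order N ! q)"
proof -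
  define i where "i = ins_order N ! q"
  have "i \<in> {2..N}" unfolding i_def set_ins_order[symmetric] using assms by simp
  then have "precedes 1 i" using ins_group_ge_2[of i] by (simp add: precedes_def)
  moreover have "set (take q (ins_order N)) = {l \<in> {2..N}. precedes l i}"
    using set_take_sorted_wrt[OF sorted_ins_order asymp_precedes assms]
    by (simp add: set_ins_order i_def)
  moreover have "l \<in> {1..N} \<longleftrightarrow> l = 1 \<or> l \<in> {2..N}" for l using \<open>i \<in> {2..N}\<close> by auto
  ultimately show ?thesis unfolding prior_def i_def[symmetric] by blast
qed

lemma prior_eq:
  assumes "2 \<le> i" "i \<le> N"
  shows "prior N i = {1..tJ (ins_group i - 1)} \<union> {i<..min (tJ (ins_group i)) N}"
proof -
  have earlier: "ins_group l < ins_group i \<longleftrightarrow> l \<le> tJ (ins_group i - 1)" for l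
    using ins_group_le_iff[of l "ins_group i - 1"] ins_group_ge_2[OF assms(1)] by linarith
  have same: "ins_group l = ins_group i \<longleftrightarrow> l \<le> tJ (ins_group i)" if "i < l" for l
    using earlier[of l] earlier[of i] that ins_group_le_iff[of l "ins_group i"] by linarith
  show ?thesis
  proof (rule set_eqI)
    fix l
    have "precedes l i \<longleftrightarrow> l \<le> tJ (ins_group i - 1) \<or> i < l \<and> l \<le> tJ (ins_group i)"
      unfolding precedes_def using earlier[of l] same[of l] by blast
    then show "l \<in> prior N i \<longleftrightarrow>
        l \<in> {1..tJ (ins_group i - 1)} \<union> {i<..min (tJ (ins_group i)) N}"
      using assms tJ_pred_ins_group_less[OF assms(1)] by (auto simp: prior_def)
  qed
qed

lemma prior_subset: "prior N i \<subseteq> {1..N}"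
  by (auto simp: prior_def)

lemma notin_prior: "i \<notin> prior N i"
  by (simp add: prior_def precedes_def)

lemma add_card_prior:
  assumes "2 \<le> i" "i \<le> N"
  shows "i + card (prior N i) = tJ (ins_group i - 1) + min (tJ (ins_group i)) N"
  using assms tJ_pred_ins_group_less[OF assms(1)] le_tJ_ins_group[of i]
  by (subst prior_eq, simp_all) (subst card_Un_disjoint, auto)

lemma add_card_prior_le:
  assumes "2 \<le> i" "i \<le> N"
  shows "i + card (prior N i) \<le> 2 ^ ins_group i"
  using add_card_prior[OF assms] tJ_Suc_add_tJ[of "ins_group i - 1"] ins_group_ge_2[OF assms(1)]
  by simp

lemma two_power_ins_group_le:
  assumes "2 \<le> i"
  shows "2 ^ ins_group i \<le> 2 * (i + tJ (ins_group i - 1))"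
proof -
  obtain k where k: "ins_group i = Suc k"
    using ins_group_ge_2[OF assms] by (cases "ins_group i") auto
  have "tJ (Suc k) \<le> 2 * tJ k + 1" by (auto simp: tJ_Suc)
  then show ?thesis using tJ_Suc_add_tJ[of k] tJ_pred_ins_group_less[OF assms] by (simp add: k)
qed

subsection \<open>Pairs and recursion\<close>

fun pairs :: "'a::linorder list \<Rightarrow> ('a \<times> 'a) list" where
  "pairs (x # y # zs) = (max x y, min x y) # pairs zs"
| "pairs xs = []"

definition leftover :: "'a list \<Rightarrow> 'a list" where
  "leftover xs = (if odd (length xs) then [last xs] else [])"

definition upper :: "'a::linorder list \<Rightarrow> 'a list" where
  "upper xs = map fst (sort_key fst (pairs xs))"

definition lower :: "'a::linorder list \<Rightarrow> 'a list" where
  "lower xs = map snd (sort_key fst (pairs xs)) @ leftover xs"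

lemma pairs_conv_nth:
  "pairs xs = map (\<lambda>i. (max (xs ! (2 * i)) (xs ! (2 * i + 1)),
                        min (xs ! (2 * i)) (xs ! (2 * i + 1)))) [0 ..< length xs div 2]"
proof (induction xs rule: pairs.induct)
  case (1 x y zs)
  have "[0 ..< length (x # y # zs) div 2] = 0 # map Suc [0 ..< length zs div 2]"
    by (simp add: upt_conv_Cons map_Suc_upt del: upt_Suc)
  then show ?case using 1 by (simp del: upt_Suc)
qed simp_all

lemma length_pairs [simp]: "length (pairs xs) = length xs div 2"
  by (simp add: pairs_conv_nth)

lemma length_upper [simp]: "length (upper xs) = length xs div 2"
  by (simp add: upper_def)

lemma length_lower [simp]: "length (lower xs) = (length xs + 1) div 2"
  by (auto simp: lower_def leftover_def elim: oddE evenE)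

lemma leftover_Cons_Cons: "leftover (x # y # zs) = leftover zs"
  by (auto simp: leftover_def)

lemma mset_pairs_leftover:
  "mset (map fst (pairs xs)) + mset (map snd (pairs xs)) + mset (leftover xs) = mset xs"
proof (induction xs rule: pairs.induct)
  case (1 x y zs)
  have "{#max x y, min x y#} = {#x, y#}" by (simp add: max_def min_def add_mset_commute)
  then show ?case using 1 by (simp add: leftover_Cons_Cons add_mset_commute)
qed (simp_all add: leftover_def)

lemma mset_upper_lower: "mset (upper xs @ lower xs) = mset xs"
  using mset_pairs_leftover[of xs] by (simp add: upper_def lower_def add.assoc)

lemma set_upper_lower: "set (upper xs) \<union> set (lower xs) = set xs"
  using mset_eq_setD[OF mset_upper_lower] by simp

lemma distinct_upper_lower: "distinct xs \<Longrightarrow> distinct (upper xs @ lower xs)"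
  using mset_eq_imp_distinct_iff[OF mset_upper_lower] by blast

lemma set_upper: "set (upper xs) = fst ` set (pairs xs)"
  by (simp add: upper_def)

lemma distinct_fst_pairs:
  assumes "distinct xs"
  shows "distinct (map fst (pairs xs))"
proof -
  have "mset (map fst (pairs xs)) = mset (upper xs)" by (simp add: upper_def)
  then show ?thesis
    using distinct_upper_lower[OF assms] mset_eq_imp_distinct_iff by fastforce
qed

lemma strict_sorted_upper: "distinct xs \<Longrightarrow> sorted_wrt (<) (upper xs)"
  using distinct_upper_lower[of xs] by (simp add: upper_def strict_sorted_iff)

lemma upper_eq_sorted_list_of_set:
  "distinct xs \<Longrightarrow> upper xs = sorted_list_of_set (set (map fst (pairs xs)))"
  by (intro strict_sorted_eq_sorted_list_of_set strict_sorted_upper) (simp_all add: set_upper)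

lemma pairs_less: "distinct xs \<Longrightarrow> (a, b) \<in> set (pairs xs) \<Longrightarrow> b < a"
  by (induction xs rule: pairs.induct) (auto simp: max_def min_def)

lemma nth_upper_lower_mem_pairs:
  assumes "i < length xs div 2"
  shows "(upper xs ! i, lower xs ! i) \<in> set (pairs xs)"
proof -
  have "(upper xs ! i, lower xs ! i) = sort_key fst (pairs xs) ! i"
    using assms by (simp add: upper_def lower_def nth_append)
  also have "\<dots> \<in> set (sort_key fst (pairs xs))"
    using assms by (intro nth_mem) simp
  finally show ?thesis by simp
qed

lemma pairs_mem_nth_upper_lower:
  assumes "(a, b) \<in> set (pairs xs)"
  obtains i where "i < length xs div 2" "upper xs ! i = a" "lower xs ! i = b"
proof -
  have "(a, b) \<in> set (sort_key fst (pairs xs))" using assms by simp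
  then obtain i where "i < length xs div 2" "sort_key fst (pairs xs) ! i = (a, b)"
    by (metis in_set_conv_nth length_sort length_pairs)
  then show ?thesis using that[of i] by (simp add: upper_def lower_def nth_append)
qed

lemma sorted_pairing_upper_lower:
  assumes "distinct xs"
  shows "sorted_pairing (upper xs) (lower xs)"
proof
  show "lower xs ! i < upper xs ! i" if "i < length (upper xs)" for i
    using that pairs_less[OF assms nth_upper_lower_mem_pairs] by simp
qed (use assms strict_sorted_upper distinct_upper_lower in auto)

lemma map_the_map_of_upper:
  assumes "distinct xs"
  shows "map (\<lambda>a. the (map_of (pairs xs) a)) (upper xs) = map snd (sort_key fst (pairs xs))"
  using distinct_fst_pairs[OF assms] by (auto simp: upper_def)

lemma upper_lower_map:
  assumes "distinct xs" "inj f" and pairing: "sorted_pairing (map f (upper xs)) (map f (lower xs))"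
  shows "upper (map f xs) = map f (upper xs)" "lower (map f xs) = map f (lower xs)"
proof -
  interpret sorted_pairing "map f (upper xs)" "map f (lower xs)" by (rule pairing)
  have less: "f b < f a" if "(a, b) \<in> set (pairs xs)" for a b
    using that
  proof (rule pairs_mem_nth_upper_lower)
    fix i assume "i < length xs div 2" "upper xs ! i = a" "lower xs ! i = b"
    then show "f b < f a" using nth_bs_less[of i] by simp
  qed
  then have pairs_map: "pairs (map f xs) = map (map_prod f f) (pairs xs)"
    by (induction xs rule: pairs.induct) (force simp: max_def min_def)+
  have sort_map: "sort_key fst (pairs (map f xs)) = map (map_prod f f) (sort_key fst (pairs xs))"
  proof (rule sort_key_inj_key_eq)
    have "distinct (map f xs)" using assms(1,2) by (auto simp: distinct_map intro: inj_on_subset)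
    then show "inj_on fst (set (pairs (map f xs)))" using distinct_fst_pairs distinct_map by blast
    show "sorted (map fst (map (map_prod f f) (sort_key fst (pairs xs))))"
      using strict_sorted_as by (simp add: upper_def strict_sorted_iff)
  qed (simp add: pairs_map)
  show "upper (map f xs) = map f (upper xs)" by (simp add: upper_def sort_map)
  have "leftover (map f xs) = map f (leftover xs)"
    by (cases "xs = []") (simp_all add: leftover_def last_map)
  then show "lower (map f xs) = map f (lower xs)" by (simp add: lower_def sort_map)
qed

definition insertion_phase_cost :: "'a::linorder list \<Rightarrow> nat" where
  "insertion_phase_cost xs =
     (\<Sum>i = 2..length (lower xs). ins_cost (upper xs) (lower xs) (prior (length (lower xs)) i) i)"

lemma foldl_ins_order:
  assumes "distinct xs" "length xs \<ge> 2"
  shows "foldl (ins_step (upper xs) (lower xs)) (hd (lower xs) # upper xs, 0)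
      (ins_order (length (lower xs))) = (sorted_list_of_set (set xs), insertion_phase_cost xs)"
proof -
  interpret sorted_pairing "upper xs" "lower xs" using assms(1) by (rule sorted_pairing_upper_lower)
  let ?N = "length (lower xs)"
  have "upper xs \<noteq> []" using assms(2) by (simp flip: length_greater_0_conv)
  have "insert 1 (set (ins_order ?N)) = {1..?N}" using assms(2) by (auto simp: set_ins_order)
  then have chain: "main_chain (upper xs) (lower xs) (insert 1 (set (ins_order ?N))) = set xs"
    using image_nth_pred[of ?N "lower xs"] by (simp add: main_chain_def set_upper_lower)
  have "(\<Sum>q<length (ins_order ?N). ins_cost (upper xs) (lower xs)
        (insert 1 (set (take q (ins_order ?N)))) (ins_order ?N ! q))
     = (\<Sum>q<length (ins_order ?N). ins_cost (upper xs) (lower xs)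
        (prior ?N (ins_order ?N ! q)) (ins_order ?N ! q))"
    by (intro sum.cong refl) (simp only: insert_take_ins_order lessThan_iff)
  also have "\<dots> = (\<Sum>i\<in>set (ins_order ?N). ins_cost (upper xs) (lower xs) (prior ?N i) i)"
    using sum.reindex_bij_betw[OF bij_betw_nth[OF distinct_ins_order refl refl]] .
  finally show ?thesis
    using foldl_ins_step[OF \<open>upper xs \<noteq> []\<close>, of "ins_order ?N"] chain
    by (simp only: set_ins_order distinct_ins_order insertion_phase_cost_def subset_refl)
qed

declare merge_insertion.simps [simp del]

lemma merge_insertion_unfold:
  assumes "distinct xs" "length xs \<ge> 2"
    and rec: "fst (merge_insertion (map fst (pairs xs))) = upper xs"
  shows "merge_insertion xs = (sorted_list_of_set (set xs),
     length xs div 2 + snd (merge_insertion (map fst (pairs xs))) + insertion_phase_cost xs)"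
proof -
  define c where "c = snd (merge_insertion (map fst (pairs xs)))"
  have rec_eq: "merge_insertion (map fst (pairs xs)) = (upper xs, c)"
    using rec by (simp add: c_def prod_eq_iff)
  have lower_eq: "map (\<lambda>a. the (map_of (pairs xs) a)) (upper xs) @
      (if odd (length xs) then [last xs] else []) = lower xs"
    by (simp only: map_the_map_of_upper[OF assms(1)] lower_def leftover_def)
  have step_eq: "(\<lambda>(ch, c) i.
      let rng = (if i \<le> length xs div 2 then takeWhile (\<lambda>z. z \<noteq> upper xs ! (i - 1)) ch else ch)
      in case binsert (lower xs ! (i - 1)) rng of (r, c') \<Rightarrow> (r @ drop (length rng) ch, c + c'))
      = ins_step (upper xs) (lower xs)"
    by (simp add: ins_step_def)
  show ?thesis
    using assms(2)
    by (subst merge_insertion.simps)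
      (simp only: pairs_conv_nth[symmetric] Let_def rec_eq lower_eq prod.case
        step_eq[unfolded Let_def] foldl_ins_order[OF assms(1,2)], simp)
qed

lemma fst_merge_insertion:
  "distinct xs \<Longrightarrow> fst (merge_insertion xs) = sorted_list_of_set (set xs)"
proof (induction xs rule: length_induct)
  case (1 xs)
  show ?case
  proof (cases "length xs \<ge> 2")
    case True
    then have "fst (merge_insertion (map fst (pairs xs))) = upper xs"
      using 1 distinct_fst_pairs[of xs] by (simp add: upper_eq_sorted_list_of_set)
    then show ?thesis using merge_insertion_unfold[OF 1(2) True] by simp
  next
    case False
    then have "length xs \<le> 1" by simp
    then show ?thesis by (cases xs) (auto simp: merge_insertion.simps)
  qed
qed

lemma snd_merge_insertion:
  assumes "distinct xs" "length xs \<ge> 2"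
  shows "snd (merge_insertion xs) =
     length xs div 2 + snd (merge_insertion (map fst (pairs xs))) + insertion_phase_cost xs"
proof -
  have "fst (merge_insertion (map fst (pairs xs))) = upper xs"
    using distinct_fst_pairs[OF assms(1)]
    by (simp add: fst_merge_insertion upper_eq_sorted_list_of_set assms(1))
  from merge_insertion_unfold[OF assms this] show ?thesis by simp
qed

subsection \<open>Exchanging values\<close>

lemma transpose_less_iff_above:
  fixes u :: "'a::linorder"
  shows "x < u \<Longrightarrow> y < u \<Longrightarrow> transpose x y z < transpose x y u \<longleftrightarrow> z < u"
  by (auto simp: transpose_def)

lemma (in sorted_pairing) sorted_pairing_map:
  assumes "inj f"
    and mono: "\<And>x y. x \<in> set as \<Longrightarrow> y \<in> set as \<Longrightarrow> x < y \<Longrightarrow> f x < f y"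
    and less: "\<And>i. i < length as \<Longrightarrow> f (bs ! i) < f (as ! i)"
  shows "sorted_pairing (map f as) (map f bs)"
proof
  show "sorted_wrt (<) (map f as)"
    unfolding sorted_wrt_map
    using strict_sorted_as mono by (auto elim: sorted_wrt_mono_rel[rotated])
  have "distinct (map f (as @ bs))"
    using distinct_append assms(1)
    by (auto simp del: map_append simp: distinct_map intro: inj_on_subset)
  then show "distinct (map f as @ map f bs)" by simp
qed (use less length_as_le length_bs_le in auto)

context insertion
begin

lemma ins_range_map:
  assumes "\<And>z. j \<le> length as \<Longrightarrow> f z < f (as ! (j - 1)) \<longleftrightarrow> z < as ! (j - 1)"
  shows "ins_range (map f as) (map f bs) P j = f ` range_j"
proof -
  have "map f bs ! (l - 1) = f (bs ! (l - 1))" if "l \<in> P" for l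
    using that by (intro nth_map pred_inserted_less)
  then have "main_chain (map f as) (map f bs) P = f ` main_chain as bs P"
    by (auto simp: main_chain_def image_Un image_image)
  moreover have "j \<le> length as \<Longrightarrow> map f as ! (j - 1) = f (as ! (j - 1))"
    using index_j by auto
  ultimately show ?thesis using assms by (auto simp: ins_range_def)
qed

lemma nth_new_map: "map f bs ! (j - 1) = f new"
  using index_j by (subst nth_map) auto

lemma Max_below_new:
  assumes "ins_rank as bs P j \<noteq> 0"
  defines "z \<equiv> Max {y \<in> range_j. y < new}"
  shows "z \<in> range_j" "z < new" "\<forall>y\<in>range_j. y < new \<longrightarrow> y \<le> z"
proof -
  have "finite {y \<in> range_j. y < new}" using finite_inserted by simp
  moreover from this have "{y \<in> range_j. y < new} \<noteq> {}"
    using assms(1) by (auto simp: ins_rank_def)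
  ultimately have "z \<in> {y \<in> range_j. y < new}" unfolding z_def by (rule Max_in)
  then show "z \<in> range_j" "z < new" by auto
  show "\<forall>y\<in>range_j. y < new \<longrightarrow> y \<le> z"
    unfolding z_def using finite_inserted by (auto intro: Max_ge)
qed

context
  fixes z
  assumes z: "z \<in> range_j" "z < new" and adjacent: "\<forall>y\<in>range_j. y < new \<longrightarrow> y \<le> z"
begin

lemma new_less_if_predecessor_less:
  assumes "u \<in> set as" "z < u"
  shows "new < u"
proof (rule ccontr)
  assume "\<not> new < u"
  then have "u < new" using new_notin_as assms(1) by (metis linorder_neqE)
  then have "u \<in> range_j"
    using assms(1) new_less by (auto simp: ins_range_def main_chain_def)
  with adjacent \<open>u < new\<close> \<open>z < u\<close> show False by force
qed

lemma transpose_predecessor_mono: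
  assumes "u \<in> set as" "x < u"
  shows "transpose z new x < transpose z new u"
proof -
  have "u \<noteq> new" using assms(1) new_notin_as by blast
  then show ?thesis
    using assms(2) z(2) new_less_if_predecessor_less[OF assms(1)] by (auto simp: transpose_def)
qed

lemma sorted_pairing_exchange_predecessor:
  "sorted_pairing (map (transpose z new) as) (map (transpose z new) bs)"
proof (rule sorted_pairing_map)
  show "transpose z new (bs ! i) < transpose z new (as ! i)" if "i < length as" for i
    using that nth_bs_less by (intro transpose_predecessor_mono) auto
qed (simp, rule transpose_predecessor_mono)

lemma ins_range_exchange_predecessor:
  "ins_range (map (transpose z new) as) (map (transpose z new) bs) P j = insert new (range_j - {z})"
proof -
  have "ins_range (map (transpose z new) as) (map (transpose z new) bs) P j =
      transpose z new ` range_j"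
  proof (rule ins_range_map)
    fix y assume "j \<le> length as"
    then have "new < as ! (j - 1)" by (rule new_less)
    then show "transpose z new y < transpose z new (as ! (j - 1)) \<longleftrightarrow> y < as ! (j - 1)"
      using z(2) by (intro transpose_less_iff_above) (rule less_trans)
  qed
  also have "\<dots> = insert new (range_j - {z})"
    using z(1) new_notin_range by (auto simp: transpose_def image_def)
  finally show ?thesis .
qed

lemma card_range_exchange_predecessor: "card (insert new (range_j - {z})) = card range_j"
  using z(1) new_notin_range finite_inserted
  by (simp add: card_Suc_Diff1 del: card_Diff_insert card_Diff_singleton)

lemma rank_exchange_predecessor:
  "Suc (card {y \<in> insert new (range_j - {z}). y < z}) = ins_rank as bs P j"
proof -
  have "{y \<in> range_j. y < new} = insert z {y \<in> range_j. y < z}"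
    using z adjacent by (auto simp: le_less dest: less_trans)
  moreover have "{y \<in> insert new (range_j - {z}). y < z} = {y \<in> range_j. y < z}"
    using z by auto
  ultimately show ?thesis using finite_inserted by (simp add: ins_rank_def)
qed

lemma successor_exchange_predecessor: "Min {y \<in> insert new (range_j - {z}). z < y} = new"
proof (rule Min_eqI)
  fix y assume "y \<in> {y \<in> insert new (range_j - {z}). z < y}"
  then show "new \<le> y" using adjacent by force
qed (use z finite_inserted in auto)

end

lemma new_less_range: "ins_rank as bs P j = 0 \<Longrightarrow> y \<in> range_j \<Longrightarrow> new < y"
  using finite_inserted new_notin_range by (auto simp: ins_rank_def) (metis linorder_neqE)

lemma sorted_pairing_exchange_earlier:
  assumes l: "l \<in> P" "l < j" and less: "new < bs ! (l - 1)"
  shows "sorted_pairing (map (transpose new (bs ! (l - 1))) as)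
    (map (transpose new (bs ! (l - 1))) bs)"
proof (rule sorted_pairing_map)
  let ?f = "transpose new (bs ! (l - 1))"
  have "l \<in> {1..length bs}" using l inserted_subset by blast
  then have "bs ! (l - 1) \<notin> set as" by (intro nth_bs_notin_as) auto
  then have fixed: "?f u = u" if "u \<in> set as" for u
    using that new_notin_as by (auto simp: transpose_def)
  then show "?f x < ?f y" if "x \<in> set as" "y \<in> set as" "x < y" for x y
    using that by simp
  show "?f (bs ! i) < ?f (as ! i)" if i: "i < length as" for i
  proof (cases "bs ! i = new")
    case True
    then have "i = j - 1"
      using nth_pred_bs_eq_iff[of "Suc i" j] index_j i length_as_le by auto
    then have "bs ! (l - 1) \<in> range_j" "j \<le> length as"
      using earlier_mem_range l i by auto
    then have "bs ! (l - 1) < as ! i" using \<open>i = j - 1\<close> by (simp add: ins_range_def)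
    moreover have "?f (as ! i) = as ! i" using i by (intro fixed) simp
    ultimately show ?thesis using True by simp
  next
    case False
    moreover have "?f (as ! i) = as ! i" using i by (intro fixed) simp
    ultimately show ?thesis using less nth_bs_less[OF i] by (auto simp: transpose_def)
  qed
qed simp

lemma exchange_earlier_nth:
  assumes l: "l \<in> P" "l \<noteq> j"
  shows "map (transpose new (bs ! (l - 1))) bs ! (j - 1) = bs ! (l - 1)"
    and "map (transpose new (bs ! (l - 1))) bs ! (l - 1) = new"
    and "\<And>l'. l' \<in> P \<Longrightarrow> l' \<noteq> l \<Longrightarrow>
      map (transpose new (bs ! (l - 1))) bs ! (l' - 1) = bs ! (l' - 1)"
proof -
  show "map (transpose new (bs ! (l - 1))) bs ! (j - 1) = bs ! (l - 1)"
    unfolding nth_new_map by simp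
  show "map (transpose new (bs ! (l - 1))) bs ! (l - 1) = new"
    using pred_inserted_less[OF l(1)] by simp
  fix l' assume l': "l' \<in> P" "l' \<noteq> l"
  then have "bs ! (l' - 1) \<noteq> bs ! (l - 1)" "bs ! (l' - 1) \<noteq> new"
    using inserted_subset l index_j j_notin nth_pred_bs_eq_iff by (metis subsetD)+
  then show "map (transpose new (bs ! (l - 1))) bs ! (l' - 1) = bs ! (l' - 1)"
    using pred_inserted_less[OF l'(1)] by (simp add: transpose_def)
qed

end

subsection \<open>Average cost of one insertion\<close>

lemma sum_comp_eq_sum_card_fibres:
  fixes F :: "'b \<Rightarrow> 'c::semiring_1"
  assumes "finite X" "finite T" "r ` X \<subseteq> T"
  shows "(\<Sum>x\<in>X. F (r x)) = (\<Sum>g\<in>T. of_nat (card {x \<in> X. r x = g}) * F g)"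
proof -
  have "(\<Sum>x\<in>X. F (r x)) = (\<Sum>g\<in>T. \<Sum>x\<in>{x \<in> X. r x = g}. F (r x))"
    using assms by (rule sum.group[symmetric])
  also have "\<dots> = (\<Sum>g\<in>T. of_nat (card {x \<in> X. r x = g}) * F g)"
    by (intro sum.cong refl) auto
  finally show ?thesis .
qed

lemma sum_binsert_cost_fixed_size_le:
  assumes "finite X" and rank: "\<And>x. x \<in> X \<Longrightarrow> r x < s"
    and s: "2 ^ k \<le> 2 * s" "s \<le> 2 ^ k"
    and antitone: "\<And>g. card {x \<in> X. r x = Suc g} \<le> card {x \<in> X. r x = g}"
  shows "(\<Sum>x\<in>X. real (binsert_cost s (r x)))
    \<le> mean_binsert_cost k s * real (card X) + real k * real (card {x \<in> X. r x = 0})"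
proof -
  define w where "w g = real (card {x \<in> X. r x = g})" for g
  have group: "(\<Sum>x\<in>X. F (r x)) = (\<Sum>g<s. w g * F g)" for F
    unfolding w_def using assms(1) rank by (intro sum_comp_eq_sum_card_fibres) auto
  have "(\<Sum>x\<in>X. real (binsert_cost s (r x))) = (\<Sum>g<s. w g * real (binsert_cost s g))"
    by (rule group)
  also have "\<dots> \<le> mean_binsert_cost k s * (\<Sum>g<s. w g) + real k * w 0"
    using s antitone by (intro sum_antitone_mult_binsert_cost_le) (auto simp: w_def)
  also have "(\<Sum>g<s. w g) = real (card X)"
    using group[of "\<lambda>_. 1"] by simp
  finally show ?thesis by (simp add: w_def)
qed

lemma sum_binsert_cost_varying_size_le:
  assumes X: "finite X" and rank: "\<And>x. x \<in> X \<Longrightarrow> r x < s x"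
    and s: "\<And>x. x \<in> X \<Longrightarrow> 2 ^ k \<le> 2 * s x" "\<And>x. x \<in> X \<Longrightarrow> s x \<le> S" "S \<le> 2 ^ k"
    and antitone: "\<And>l g. card {x \<in> X. s x = l \<and> r x = Suc g} \<le> card {x \<in> X. s x = l \<and> r x = g}"
  shows "(\<Sum>x\<in>X. real (binsert_cost (s x) (r x)))
    \<le> mean_binsert_cost k S * real (card X) + real k * real (card {x \<in> X. r x = 0})"
proof -
  define fibre where "fibre l = {x \<in> X. s x = l}" for l
  have group: "(\<Sum>x\<in>Y. F x) = (\<Sum>l\<in>s ` X. \<Sum>x\<in>{x \<in> Y. s x = l}. F x)"
    if "Y \<subseteq> X" for F :: "_ \<Rightarrow> real" and Y
    using X that by (intro sum.group[symmetric]) (auto intro: finite_subset)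
  have card: "real (card X) = (\<Sum>l\<in>s ` X. real (card (fibre l)))"
    "real (card {x \<in> X. r x = 0}) = (\<Sum>l\<in>s ` X. real (card {x \<in> fibre l. r x = 0}))"
    using group[of X "\<lambda>_. 1"] group[of "{x \<in> X. r x = 0}" "\<lambda>_. 1"]
    by (auto simp: fibre_def conj_commute intro!: sum.cong arg_cong[of _ _ card])
  have "(\<Sum>x\<in>X. real (binsert_cost (s x) (r x))) =
      (\<Sum>l\<in>s ` X. \<Sum>x\<in>fibre l. real (binsert_cost l (r x)))"
    by (subst group[OF subset_refl]) (auto simp: fibre_def intro!: sum.cong)
  also have "\<dots> \<le>
      (\<Sum>l\<in>s ` X. mean_binsert_cost k S * real (card (fibre l)) +
        real k * real (card {x \<in> fibre l. r x = 0}))"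
  proof (rule sum_mono)
    fix l assume l: "l \<in> s ` X"
    then have bounds: "2 ^ k \<le> 2 * l" "l \<le> S" using s by auto
    have "l > 0" using bounds(1) by (cases l) auto
    have "(\<Sum>x\<in>fibre l. real (binsert_cost l (r x))) \<le>
        mean_binsert_cost k l * real (card (fibre l)) +
        real k * real (card {x \<in> fibre l. r x = 0})"
      using bounds X rank s(3) antitone[of l]
      by (intro sum_binsert_cost_fixed_size_le) (auto simp: fibre_def)
    also have "mean_binsert_cost k l \<le> mean_binsert_cost k S"
      using \<open>l > 0\<close> bounds(2) by (rule mean_binsert_cost_mono)
    finally show "(\<Sum>x\<in>fibre l. real (binsert_cost l (r x))) \<le>
        mean_binsert_cost k S * real (card (fibre l)) + real k * real (card {x \<in> fibre l. r x = 0})"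
      by (simp add: mult_right_mono)
  qed
  also have "\<dots> = mean_binsert_cost k S * real (card X) + real k * real (card {x \<in> X. r x = 0})"
    by (simp add: card sum.distrib sum_distrib_left)
  finally show ?thesis .
qed

definition perm_mean :: "'a set \<Rightarrow> ('a list \<Rightarrow> real) \<Rightarrow> real" where
  "perm_mean A F = (\<Sum>xs\<in>permutations_of_set A. F xs) / fact (card A)"

lemma map_transpose_permutations_of_set:
  assumes "xs \<in> permutations_of_set A" "u \<in> A" "v \<in> A"
  shows "map (transpose u v) xs \<in> permutations_of_set A"
  using assms by (auto simp: permutations_of_set_def distinct_map transpose_image_eq)

context
  fixes A :: "'a::linorder set" and P :: "nat set" and j :: nat
  assumes A: "finite A" and j: "j \<in> {1..(card A + 1) div 2}"
    and P: "P \<subseteq> {1..(card A + 1) div 2}" "j \<notin> P"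
begin

private abbreviation "range_of xs \<equiv> ins_range (upper xs) (lower xs) P j"
private abbreviation "new_of xs \<equiv> lower xs ! (j - 1)"
private abbreviation "rank_of xs \<equiv> ins_rank (upper xs) (lower xs) P j"

lemma insertion_upper_lower:
  assumes "xs \<in> permutations_of_set A"
  shows "insertion (upper xs) (lower xs) P j"
proof -
  have "distinct xs" using assms by (rule permutations_of_setD)
  then interpret sorted_pairing "upper xs" "lower xs" by (rule sorted_pairing_upper_lower)
  have "length xs = card A" using assms by (rule length_finite_permutations_of_set)
  then show ?thesis using j P by unfold_locales auto
qed

lemma exchange_permutation:
  assumes xs: "xs \<in> permutations_of_set A" and mem: "u \<in> set (upper xs) \<union> set (lower xs)"
    "v \<in> set (upper xs) \<union> set (lower xs)"
    and pairing: "sorted_pairing (map (transpose u v) (upper xs)) (map (transpose u v) (lower xs))"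
  shows "map (transpose u v) xs \<in> permutations_of_set A"
    and "upper (map (transpose u v) xs) = map (transpose u v) (upper xs)"
    and "lower (map (transpose u v) xs) = map (transpose u v) (lower xs)"
  using map_transpose_permutations_of_set[OF xs] mem permutations_of_setD[OF xs]
    upper_lower_map[OF _ _ pairing] by (auto simp: set_upper_lower)

lemma permutation_exchange_predecessor:
  assumes xs: "xs \<in> permutations_of_set A" and rank: "rank_of xs \<noteq> 0"
  defines "ys \<equiv> map (transpose (Max {y \<in> range_of xs. y < new_of xs}) (new_of xs)) xs"
  shows "ys \<in> permutations_of_set A" "card (range_of ys) = card (range_of xs)"
    and "Suc (rank_of ys) = rank_of xs"
    and "map (transpose (new_of ys) (Min {y \<in> range_of ys. new_of ys < y})) ys = xs"
proof -
  interpret insertion "upper xs" "lower xs" P j using xs by (rule insertion_upper_lower)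
  define z where "z = Max {y \<in> range_of xs. y < new_of xs}"
  note z = Max_below_new[OF rank, folded z_def]
  have ys_eq: "ys = map (transpose z (new_of xs)) xs" by (simp add: ys_def z_def)
  note exchange = exchange_permutation[OF xs _ _ sorted_pairing_exchange_predecessor[OF z]]
  have mem: "z \<in> set (upper xs) \<union> set (lower xs)" "new_of xs \<in> set (upper xs) \<union> set (lower xs)"
    using z(1) range_subset new_mem by auto
  have new_ys: "new_of ys = z" unfolding ys_eq exchange(3)[OF mem] nth_new_map by simp
  have range_ys: "range_of ys = insert (new_of xs) (range_of xs - {z})"
    unfolding ys_eq exchange(2,3)[OF mem] by (rule ins_range_exchange_predecessor[OF z])
  show "ys \<in> permutations_of_set A" unfolding ys_eq by (rule exchange(1)[OF mem])
  show "card (range_of ys) = card (range_of xs)"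
    unfolding range_ys by (rule card_range_exchange_predecessor[OF z])
  show "Suc (rank_of ys) = rank_of xs"
    unfolding ins_rank_def[of "upper ys"] new_ys range_ys by (rule rank_exchange_predecessor[OF z])
  show "map (transpose (new_of ys) (Min {y \<in> range_of ys. new_of ys < y})) ys = xs"
    unfolding new_ys range_ys successor_exchange_predecessor[OF z] by (simp add: ys_eq map_idI)
qed

lemma card_rank_Suc_le:
  "card {xs \<in> permutations_of_set A. card (range_of xs) = s \<and> rank_of xs = Suc g}
    \<le> card {xs \<in> permutations_of_set A. card (range_of xs) = s \<and> rank_of xs = g}"
proof (rule card_inj_on_le)
  define down where
    "down xs = map (transpose (Max {y \<in> range_of xs. y < new_of xs}) (new_of xs)) xs"
    for xs :: "'a list"
  define up where
    "up ys = map (transpose (new_of ys) (Min {y \<in> range_of ys. new_of ys < y})) ys"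
    for ys :: "'a list"
  note exchange = permutation_exchange_predecessor[folded down_def, folded up_def]
  show "inj_on down {xs \<in> permutations_of_set A. card (range_of xs) = s \<and> rank_of xs = Suc g}"
    by (rule inj_on_inverseI[of _ up]) (use exchange(4) in auto)
  show "down ` {xs \<in> permutations_of_set A. card (range_of xs) = s \<and> rank_of xs = Suc g}
      \<subseteq> {xs \<in> permutations_of_set A. card (range_of xs) = s \<and> rank_of xs = g}"
  proof (rule image_subsetI)
    fix xs assume "xs \<in> {xs \<in> permutations_of_set A. card (range_of xs) = s \<and> rank_of xs = Suc g}"
    then have "xs \<in> permutations_of_set A" "card (range_of xs) = s" "rank_of xs = Suc g" by auto
    with exchange(1-3)[of xs]
    show "down xs \<in> {xs \<in> permutations_of_set A. card (range_of xs) = s \<and> rank_of xs = g}"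
      by (metis (mono_tags, lifting) mem_Collect_eq nat.inject nat.distinct(1))
  qed
qed (use A in simp)

lemma permutation_exchange_earlier:
  assumes t: "{1..t} \<subseteq> P" "t < j"
    and xs: "xs \<in> permutations_of_set A" and rank: "rank_of xs = 0" and l: "l \<in> {1..t}"
  defines "ys \<equiv> map (transpose (new_of xs) (lower xs ! (l - 1))) xs"
  shows "ys \<in> permutations_of_set A"
    and "map (transpose (lower ys ! (l - 1)) (new_of ys)) ys = xs"
    and "\<And>l'. l' \<in> {1..t} \<Longrightarrow> l' \<noteq> l \<Longrightarrow> lower ys ! (l - 1) < lower ys ! (l' - 1)"
proof -
  interpret insertion "upper xs" "lower xs" P j using xs by (rule insertion_upper_lower)
  have lP: "l \<in> P" "l < j" "l \<noteq> j" using l t by auto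
  have earlier: "lower xs ! (l' - 1) \<in> range_of xs" if "l' \<in> {1..t}" for l'
    using that t by (intro earlier_mem_range) auto
  have less: "new_of xs < lower xs ! (l' - 1)" if "l' \<in> {1..t}" for l'
    using rank earlier[OF that] by (rule new_less_range)
  note exchange = exchange_permutation[OF xs _ _
      sorted_pairing_exchange_earlier[OF lP(1,2) less[OF l]]]
  have mem: "new_of xs \<in> set (upper xs) \<union> set (lower xs)"
      "lower xs ! (l - 1) \<in> set (upper xs) \<union> set (lower xs)"
    using earlier[OF l] range_subset new_mem by auto
  show "ys \<in> permutations_of_set A" unfolding ys_def by (rule exchange(1)[OF mem])
  have lower_ys: "lower ys = map (transpose (new_of xs) (lower xs ! (l - 1))) (lower xs)"
    unfolding ys_def by (rule exchange(3)[OF mem])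
  show "map (transpose (lower ys ! (l - 1)) (new_of ys)) ys = xs"
    unfolding lower_ys exchange_earlier_nth[OF lP(1,3)] by (simp add: ys_def map_idI)
  show "lower ys ! (l - 1) < lower ys ! (l' - 1)" if l': "l' \<in> {1..t}" "l' \<noteq> l" for l'
  proof -
    have "l' \<in> P" using l'(1) t by blast
    from exchange_earlier_nth(3)[OF lP(1,3) this l'(2)] show ?thesis
      unfolding lower_ys exchange_earlier_nth(2)[OF lP(1,3)] using less[OF l'(1)] by (rule ssubst)
  qed
qed

text \<open>An inserted element below its whole range exchanges its value with one of \<open>b\<^sub>1, ..., b\<^sub>t\<close>,
  which can be recovered as the smallest of them.\<close>
lemma card_rank_0_le:
  assumes t: "{1..t} \<subseteq> P" "t < j"
  shows "t * card {xs \<in> permutations_of_set A. rank_of xs = 0} \<le> card (permutations_of_set A)"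
proof -
  define E where "E = {xs \<in> permutations_of_set A. rank_of xs = 0}"
  define exch where "exch l xs = map (transpose (new_of xs) (lower xs ! (l - 1))) xs"
    for l and xs :: "'a list"
  note exchange = permutation_exchange_earlier[OF t, folded exch_def]
  have "inj_on (\<lambda>(l, xs). exch l xs) ({1..t} \<times> E)"
  proof (rule inj_onI, clarify)
    fix l xs l' xs'
    assume l: "l \<in> {1..t}" "l' \<in> {1..t}" and "xs \<in> E" "xs' \<in> E" and eq: "exch l xs = exch l' xs'"
    then have xs: "xs \<in> permutations_of_set A" "rank_of xs = 0"
      and xs': "xs' \<in> permutations_of_set A" "rank_of xs' = 0"
      by (simp_all add: E_def)
    have "l = l'"
      using exchange(3)[OF xs l(1) l(2)] exchange(3)[OF xs' l(2) l(1)] unfolding eq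
      by (metis less_asym)
    moreover from this have "xs = xs'"
      using exchange(2)[OF xs l(1)] exchange(2)[OF xs' l(2)] eq by metis
    ultimately show "l = l' \<and> xs = xs'" by blast
  qed
  moreover have "exch l xs \<in> permutations_of_set A" if "l \<in> {1..t}" "xs \<in> E" for l xs
    by (rule exchange(1)) (use that in \<open>simp_all add: E_def\<close>)
  then have "(\<lambda>(l, xs). exch l xs) ` ({1..t} \<times> E) \<subseteq> permutations_of_set A" by auto
  ultimately have "card ({1..t} \<times> E) \<le> card (permutations_of_set A)"
    by (rule card_inj_on_le) (use A in simp)
  then show ?thesis by (simp add: E_def card_cartesian_product)
qed

lemma perm_mean_ins_cost_le:
  assumes t: "{1..t} \<subseteq> P" "t < j" "t > 0"
    and S: "j + card P \<le> S" "S \<le> 2 ^ k" "2 ^ k \<le> 2 * (j + t)"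
  shows "perm_mean A (\<lambda>xs. real (ins_cost (upper xs) (lower xs) P j))
    \<le> mean_binsert_cost k S + real k / real t"
proof -
  let ?X = "permutations_of_set A"
  have bounds: "rank_of xs < Suc (card (range_of xs))"
      "2 ^ k \<le> 2 * Suc (card (range_of xs))" "Suc (card (range_of xs)) \<le> S"
    if "xs \<in> ?X" for xs
  proof -
    interpret insertion "upper xs" "lower xs" P j using that by (rule insertion_upper_lower)
    show "rank_of xs < Suc (card (range_of xs))"
      unfolding ins_rank_def less_Suc_eq_le using finite_inserted by (intro card_mono) auto
    show "2 ^ k \<le> 2 * Suc (card (range_of xs))" "Suc (card (range_of xs)) \<le> S"
      using card_range_le card_range_ge[OF t(1,2)] S index_j by auto
  qed
  have antitone: "card {xs \<in> ?X. Suc (card (range_of xs)) = s \<and> rank_of xs = Suc g}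
      \<le> card {xs \<in> ?X. Suc (card (range_of xs)) = s \<and> rank_of xs = g}" for s g
    using card_rank_Suc_le by (cases s) simp_all
  have "(\<Sum>xs\<in>?X. real (ins_cost (upper xs) (lower xs) P j))
      \<le> mean_binsert_cost k S * real (card ?X) +
        real k * real (card {xs \<in> ?X. rank_of xs = 0})"
    unfolding ins_cost_def
    by (rule sum_binsert_cost_varying_size_le[where s = "\<lambda>xs. Suc (card (range_of xs))"])
      (simp, (fact bounds S(2) antitone)+)
  also have "real (card {xs \<in> ?X. rank_of xs = 0}) \<le> real (card ?X) / real t"
  proof -
    have "real t * real (card {xs \<in> ?X. rank_of xs = 0}) \<le> real (card ?X)"
      unfolding of_nat_mult[symmetric] of_nat_le_iff by (rule card_rank_0_le[OF t(1,2)])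
    then show ?thesis using t(3) by (simp add: pos_le_divide_eq mult.commute)
  qed
  finally have "(\<Sum>xs\<in>?X. real (ins_cost (upper xs) (lower xs) P j))
      \<le> (mean_binsert_cost k S + real k / real t) * fact (card A)"
    using A by (simp add: distrib_right mult_left_mono)
  then show ?thesis by (simp add: perm_mean_def pos_divide_le_eq)
qed

end

subsection \<open>Averaging over all permutations\<close>

lemma perm_mean_cong:
  "(\<And>xs. xs \<in> permutations_of_set A \<Longrightarrow> F xs = G xs) \<Longrightarrow> perm_mean A F = perm_mean A G"
  by (simp add: perm_mean_def)

lemma perm_mean_add: "perm_mean A (\<lambda>xs. F xs + G xs) = perm_mean A F + perm_mean A G"
  by (simp add: perm_mean_def sum.distrib add_divide_distrib)

lemma perm_mean_cmult: "perm_mean A (\<lambda>xs. c * F xs) = c * perm_mean A F"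
  by (simp add: perm_mean_def sum_distrib_left)

lemma perm_mean_sum: "perm_mean A (\<lambda>xs. \<Sum>i\<in>I. F i xs) = (\<Sum>i\<in>I. perm_mean A (F i))"
  unfolding perm_mean_def sum_divide_distrib by (rule sum.swap)

lemma perm_mean_const: "finite A \<Longrightarrow> perm_mean A (\<lambda>_. c) = c"
  by (simp add: perm_mean_def)

lemma perm_mean_le:
  assumes "finite A" "\<And>xs. xs \<in> permutations_of_set A \<Longrightarrow> F xs \<le> c"
  shows "perm_mean A F \<le> c"
proof -
  have "perm_mean A F \<le> perm_mean A (\<lambda>_. c)"
    unfolding perm_mean_def using assms(2) by (intro divide_right_mono sum_mono) auto
  then show ?thesis using assms(1) by (simp add: perm_mean_const)
qed

lemma bij_betw_permute_list_permutations_of_set: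
  assumes p: "p permutes {..<card A}"
  shows "bij_betw (permute_list p) (permutations_of_set A) (permutations_of_set A)"
proof (rule bij_betw_byWitness[where f' = "permute_list (inv p)"])
  have length: "length xs = card A" if "xs \<in> permutations_of_set A" for xs
    using that by (rule length_finite_permutations_of_set)
  have closed: "permute_list q ` permutations_of_set A \<subseteq> permutations_of_set A"
    if "q permutes {..<card A}" for q
    using that length by (auto simp: permutations_of_set_def)
  show "permute_list p ` permutations_of_set A \<subseteq> permutations_of_set A"
    "permute_list (inv p) ` permutations_of_set A \<subseteq> permutations_of_set A"
    using closed p permutes_inv[OF p] by blast+
  show "\<forall>xs\<in>permutations_of_set A. permute_list (inv p) (permute_list p xs) = xs"
    using permutes_inv[OF p] permutes_inv_o(1)[OF p]
    by (auto simp: length simp flip: permute_list_compose)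
  show "\<forall>xs\<in>permutations_of_set A. permute_list p (permute_list (inv p) xs) = xs"
    using p permutes_inv_o(2)[OF p] by (auto simp: length simp flip: permute_list_compose)
qed

lemma perm_mean_permute_list:
  "p permutes {..<card A} \<Longrightarrow> perm_mean A (\<lambda>xs. F (permute_list p xs)) = perm_mean A F"
  unfolding perm_mean_def
  using sum.reindex_bij_betw[OF bij_betw_permute_list_permutations_of_set] by metis

lemma bij_betw_permute_list:
  assumes "distinct ys"
  shows "bij_betw (\<lambda>p. permute_list p ys) {p. p permutes {..<length ys}}
    (permutations_of_set (set ys))"
proof -
  let ?S = "{p. p permutes {..<length ys}}"
  have image: "(\<lambda>p. permute_list p ys) ` ?S = permutations_of_set (set ys)"
  proof (intro equalityI subsetI)
    fix xs assume "xs \<in> permutations_of_set (set ys)"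
    then have "mset xs = mset ys"
      using assms permutations_of_setD set_eq_iff_mset_eq_distinct by metis
    then show "xs \<in> (\<lambda>p. permute_list p ys) ` ?S"
      by (metis image_eqI mem_Collect_eq mset_eq_permutation)
  qed (use assms in auto)
  have "card (permutations_of_set (set ys)) = card ?S"
    using assms by (simp add: card_permutations distinct_card)
  then have "inj_on (\<lambda>p. permute_list p ys) ?S"
    by (intro eq_card_imp_inj_on) (auto simp: image finite_permutations)
  with image show ?thesis by (simp add: bij_betw_def)
qed

lemma fact_mult_perm_mean_set:
  assumes "distinct ys"
  shows "fact (length ys) * perm_mean (set ys) F =
    (\<Sum>p | p permutes {..<length ys}. F (permute_list p ys))"
  using sum.reindex_bij_betw[OF bij_betw_permute_list[OF assms], of F] assms
  by (simp add: perm_mean_def distinct_card)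

definition pair_perm :: "(nat \<Rightarrow> nat) \<Rightarrow> nat \<Rightarrow> nat" where
  "pair_perm p q = 2 * p (q div 2) + q mod 2"

lemma pair_perm_permutes:
  assumes p: "p permutes {..<m}" and "2 * m \<le> n"
  shows "pair_perm p permutes {..<n}"
proof -
  have inverse: "pair_perm q (pair_perm r i) = i" if "\<And>i. q (r i) = i" for q r i
    by (simp add: pair_perm_def that)
  have "\<exists>!i. pair_perm p i = y" for y
    using inverse[of p "inv p"] inverse[of "inv p" p] permutes_inverses[OF p] by metis
  moreover have "pair_perm p i = i" if "i \<notin> {..<n}" for i
    using that assms by (simp add: pair_perm_def permutes_not_in[OF p])
  ultimately show ?thesis by (simp add: permutes_def)
qed

lemma pairs_permute_list:
  assumes p: "p permutes {..<length xs div 2}"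
  shows "pairs (permute_list (pair_perm p) xs) = permute_list p (pairs xs)"
proof (rule nth_equalityI)
  fix i assume "i < length (pairs (permute_list (pair_perm p) xs))"
  then have i: "i < length xs div 2" by simp
  then have "p i < length xs div 2" using permutes_in_image[OF p, of i] by simp
  have "pair_perm p permutes {..<length xs}" using p by (rule pair_perm_permutes) simp
  then have "permute_list (pair_perm p) xs ! (2 * i) = xs ! (2 * p i)"
    "permute_list (pair_perm p) xs ! (2 * i + 1) = xs ! (2 * p i + 1)"
    using i by (simp_all add: permute_list_nth pair_perm_def)
  then show "pairs (permute_list (pair_perm p) xs) ! i = permute_list p (pairs xs) ! i"
    using i \<open>p i < _\<close> p by (simp add: pairs_conv_nth permute_list_nth)
qed simp

text \<open>Permuting the pairs among each other shows that the list of pair maxima is a uniformly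
  distributed ordering of its underlying set.\<close>
lemma perm_mean_fst_pairs:
  fixes A :: "'a::linorder set"
  shows "perm_mean A (\<lambda>xs. F (map fst (pairs xs))) =
    perm_mean A (\<lambda>xs. perm_mean (set (map fst (pairs xs))) F)"
proof -
  define m where "m = card A div 2"
  have length: "length xs = card A" if "xs \<in> permutations_of_set A" for xs :: "'a list"
    using that by (rule length_finite_permutations_of_set)
  have permute: "perm_mean A (\<lambda>xs. F (permute_list p (map fst (pairs xs)))) =
      perm_mean A (\<lambda>xs. F (map fst (pairs xs)))" if p: "p permutes {..<m}" for p
  proof -
    have "perm_mean A (\<lambda>xs. F (permute_list p (map fst (pairs xs)))) =
        perm_mean A (\<lambda>xs. F (map fst (pairs (permute_list (pair_perm p) xs))))"
      using p by (intro perm_mean_cong)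
        (simp add: m_def length pairs_permute_list permute_list_map)
    also have "\<dots> = perm_mean A (\<lambda>xs. F (map fst (pairs xs)))"
      using p by (intro perm_mean_permute_list pair_perm_permutes) (auto simp: m_def)
    finally show ?thesis .
  qed
  have "fact m * perm_mean A (\<lambda>xs. F (map fst (pairs xs))) =
      (\<Sum>p | p permutes {..<m}. perm_mean A (\<lambda>xs. F (permute_list p (map fst (pairs xs)))))"
    by (simp add: permute card_permutations)
  also have "\<dots> = perm_mean A (\<lambda>xs. \<Sum>p | p permutes {..<m}. F (permute_list p (map fst (pairs xs))))"
    by (rule perm_mean_sum[symmetric])
  also have "\<dots> = perm_mean A (\<lambda>xs. fact m * perm_mean (set (map fst (pairs xs))) F)"
  proof (rule perm_mean_cong)
    fix xs :: "'a list" assume xs: "xs \<in> permutations_of_set A"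
    then have "distinct (map fst (pairs xs))" by (intro distinct_fst_pairs permutations_of_setD)
    then show "(\<Sum>p | p permutes {..<m}. F (permute_list p (map fst (pairs xs)))) =
        fact m * perm_mean (set (map fst (pairs xs))) F"
      using fact_mult_perm_mean_set[of "map fst (pairs xs)" F] by (simp add: m_def length[OF xs])
  qed
  also have "\<dots> = fact m * perm_mean A (\<lambda>xs. perm_mean (set (map fst (pairs xs))) F)"
    by (rule perm_mean_cmult)
  finally show ?thesis by simp
qed

definition phase_bound :: "nat \<Rightarrow> real" where
  "phase_bound N = (let k = ins_group N; t = tJ (k - 1) in
     (\<Sum>i = 2..t. real (ins_group i)) +
     (real N - real t) * (mean_binsert_cost k (N + t) + real k / real t))"

lemma phase_bound_eq_0: "N \<le> 1 \<Longrightarrow> phase_bound N = 0"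
  using ins_group_le_iff[of 0 0] by (auto simp: phase_bound_def mean_binsert_cost_def le_Suc_eq)

lemma perm_mean_ins_cost_le_group:
  fixes A :: "'a::linorder set"
  assumes A: "finite A" and j: "2 \<le> j" "j \<le> (card A + 1) div 2"
  shows "perm_mean A (\<lambda>xs. real (ins_cost (upper xs) (lower xs) (prior ((card A + 1) div 2) j) j))
    \<le> real (ins_group j)"
proof (rule perm_mean_le[OF A])
  let ?P = "prior ((card A + 1) div 2) j"
  fix xs assume "xs \<in> permutations_of_set A"
  then interpret insertion "upper xs" "lower xs" ?P j
    using A j prior_subset notin_prior by (intro insertion_upper_lower) auto
  have "Suc (card range_j) \<le> 2 ^ ins_group j"
    using card_range_le add_card_prior_le[OF j] j by simp
  then show "real (ins_cost (upper xs) (lower xs) ?P j) \<le> real (ins_group j)"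
    unfolding ins_cost_def by (simp add: binsert_cost_le)
qed

lemma perm_mean_ins_cost_le_last_group:
  fixes A :: "'a::linorder set"
  assumes A: "finite A" and N: "N = (card A + 1) div 2" "2 \<le> N"
  defines "k \<equiv> ins_group N"
  defines "t \<equiv> tJ (k - 1)"
  assumes j: "t < j" "j \<le> N"
  shows "perm_mean A (\<lambda>xs. real (ins_cost (upper xs) (lower xs) (prior N j) j))
    \<le> mean_binsert_cost k (N + t) + real k / real t"
proof -
  have "t > 0" using tJ_pos[of "k - 1"] by (simp add: t_def)
  then have "2 \<le> j" using j(1) by simp
  have group: "ins_group j = k"
    using j le_tJ_ins_group[of N] by (intro ins_group_eqI) (auto simp: k_def t_def)
  have "k \<ge> 2" unfolding k_def using N(2) by (rule ins_group_ge_2)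
  have "N \<le> tJ k" unfolding k_def by (rule le_tJ_ins_group)
  show ?thesis
  proof (rule perm_mean_ins_cost_le[OF A])
    show "j \<in> {1..(card A + 1) div 2}" "prior N j \<subseteq> {1..(card A + 1) div 2}" "j \<notin> prior N j"
      unfolding N(1)[symmetric] using \<open>2 \<le> j\<close> j prior_subset[of N j] notin_prior[of j N] by simp_all
    show "{1..t} \<subseteq> prior N j"
      using \<open>2 \<le> j\<close> j(2) by (auto simp: prior_eq group t_def)
    show "j + card (prior N j) \<le> N + t"
      using add_card_prior[OF \<open>2 \<le> j\<close> j(2)] by (simp add: group t_def)
    show "N + t \<le> 2 ^ k"
      using \<open>N \<le> tJ k\<close> tJ_Suc_add_tJ[of "k - 1"] \<open>k \<ge> 2\<close> by (simp add: t_def)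
    show "2 ^ k \<le> 2 * (j + t)"
      using two_power_ins_group_le[OF \<open>2 \<le> j\<close>] by (simp add: group t_def)
  qed (use j \<open>t > 0\<close> in auto)
qed

lemma perm_mean_insertion_phase_le:
  fixes A :: "'a::linorder set"
  assumes A: "finite A"
  shows "perm_mean A (\<lambda>xs. real (insertion_phase_cost xs)) \<le> phase_bound ((card A + 1) div 2)"
proof -
  define N where "N = (card A + 1) div 2"
  define mean where
    "mean i = perm_mean A (\<lambda>xs. real (ins_cost (upper xs) (lower xs) (prior N i) i))" for i
  have "perm_mean A (\<lambda>xs. real (insertion_phase_cost xs)) =
      perm_mean A (\<lambda>xs. \<Sum>i = 2..N. real (ins_cost (upper xs) (lower xs) (prior N i) i))"
    by (intro perm_mean_cong)
      (simp add: insertion_phase_cost_def N_def length_finite_permutations_of_set)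
  also have "\<dots> = (\<Sum>i = 2..N. mean i)" by (simp add: perm_mean_sum mean_def)
  also have "\<dots> \<le> phase_bound N"
  proof (cases "N \<le> 1")
    case False
    define k where "k = ins_group N"
    define t where "t = tJ (k - 1)"
    define c where "c = mean_binsert_cost k (N + t) + real k / real t"
    have N: "2 \<le> N" using False by simp
    have t: "1 \<le> t" "t < N"
      using tJ_pos tJ_pred_ins_group_less[OF N] by (simp_all add: t_def k_def)
    have "(\<Sum>i = 2..N. mean i) = (\<Sum>i = 2..t. mean i) + (\<Sum>i\<in>{t<..N}. mean i)"
      using t by (subst sum.union_disjoint[symmetric]) (auto intro!: sum.cong)
    also have "\<dots> \<le> (\<Sum>i = 2..t. real (ins_group i)) + (\<Sum>i\<in>{t<..N}. c)"
    proof (intro add_mono sum_mono)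
      show "mean i \<le> real (ins_group i)" if "i \<in> {2..t}" for i
        using that t(2) perm_mean_ins_cost_le_group[OF A, of i] by (simp add: mean_def N_def)
      show "mean i \<le> c" if "i \<in> {t<..N}" for i
        using that perm_mean_ins_cost_le_last_group[OF A N_def N, of i]
        by (simp add: mean_def c_def t_def k_def)
    qed
    also have "\<dots> = phase_bound N"
      unfolding phase_bound_def Let_def k_def[symmetric] t_def[symmetric] c_def[symmetric]
      using t by (simp add: of_nat_diff)
    finally show ?thesis .
  qed (simp add: phase_bound_eq_0)
  finally show ?thesis by (simp add: N_def)
qed

fun avg_bound :: "nat \<Rightarrow> real" where
  "avg_bound n = (if n \<le> 1 then 0
     else real (n div 2) + avg_bound (n div 2) + phase_bound ((n + 1) div 2))"

declare avg_bound.simps [simp del]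

lemma perm_mean_merge_insertion_rec:
  fixes A :: "'a::linorder set"
  assumes "finite A" "card A \<ge> 2"
  defines "cost \<equiv> \<lambda>xs :: 'a list. real (snd (merge_insertion xs))"
  shows "perm_mean A cost = real (card A div 2) +
    perm_mean A (\<lambda>xs. perm_mean (set (map fst (pairs xs))) cost) +
    perm_mean A (\<lambda>xs. real (insertion_phase_cost xs))"
proof -
  have "perm_mean A cost = perm_mean A (\<lambda>xs. real (card A div 2) +
      cost (map fst (pairs xs)) + real (insertion_phase_cost xs))"
    using assms(2)
    by (intro perm_mean_cong) (simp add: cost_def snd_merge_insertion permutations_of_setD
        length_finite_permutations_of_set)
  also have "\<dots> = real (card A div 2) + perm_mean A (\<lambda>xs. cost (map fst (pairs xs))) +
      perm_mean A (\<lambda>xs. real (insertion_phase_cost xs))"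
    using assms(1) by (simp add: perm_mean_add perm_mean_const)
  finally show ?thesis by (simp only: perm_mean_fst_pairs)
qed

lemma perm_mean_merge_insertion_le:
  fixes A :: "'a::linorder set"
  assumes "finite A"
  shows "perm_mean A (\<lambda>xs. real (snd (merge_insertion xs))) \<le> avg_bound (card A)"
  using assms
proof (induction "card A" arbitrary: A rule: less_induct)
  case less
  let ?cost = "\<lambda>xs :: 'a list. real (snd (merge_insertion xs))"
  have length: "length xs = card A" if "xs \<in> permutations_of_set A" for xs :: "'a list"
    using that by (rule length_finite_permutations_of_set)
  show ?case
  proof (cases "card A \<le> 1")
    case True
    then show ?thesis
      using less.prems
      by (intro perm_mean_le) (simp_all add: merge_insertion.simps avg_bound.simps length)
  next
    case False
    define m where "m = card A div 2"
    have "perm_mean A ?cost = real m +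
        perm_mean A (\<lambda>xs. perm_mean (set (map fst (pairs xs))) ?cost) +
        perm_mean A (\<lambda>xs. real (insertion_phase_cost xs))"
      using less.prems False unfolding m_def by (intro perm_mean_merge_insertion_rec) auto
    also have "perm_mean A (\<lambda>xs. perm_mean (set (map fst (pairs xs))) ?cost) \<le> avg_bound m"
    proof (rule perm_mean_le[OF less.prems])
      fix xs :: "'a list" assume xs: "xs \<in> permutations_of_set A"
      have "card (set (map fst (pairs xs))) = m"
        using distinct_card[OF distinct_fst_pairs[OF permutations_of_setD(2)[OF xs]]]
        by (simp add: m_def length[OF xs])
      then show "perm_mean (set (map fst (pairs xs))) ?cost \<le> avg_bound m"
        using less.hyps[of "set (map fst (pairs xs))"] False by (simp add: m_def)
    qed
    also have "perm_mean A (\<lambda>xs. real (insertion_phase_cost xs)) \<le>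
        phase_bound ((card A + 1) div 2)"
      using less.prems by (rule perm_mean_insertion_phase_le)
    also have "real m + avg_bound m + phase_bound ((card A + 1) div 2) = avg_bound (card A)"
      using False by (subst (2) avg_bound.simps) (simp add: m_def)
    finally show ?thesis by simp
  qed
qed

lemma avg_comparisons_MI_le: "avg_comparisons_MI n \<le> avg_bound n"
  using perm_mean_merge_insertion_le[of "{0..<n}"]
  by (simp add: avg_comparisons_MI_def perm_mean_def)

subsection \<open>Asymptotic analysis\<close>

lemma ln_2_bounds: "ln (2::real) \<in> {6931442 / 10 ^ 7 .. 693148 / 10 ^ 6}"
  using ln_approx_bounds[of 2 5] by (simp add: eval_nat_numeral)

lemma has_real_derivative_ln_add_inverse:
  fixes x w :: real
  assumes "x > 0" "w > 0"
  shows "((\<lambda>x. ln x + (3 * w + 2)^2 / (3 * w * (3 * x + 2))) has_real_derivative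
    (x - w) * (9 * (x * w) - 4) / (w * x * (3 * x + 2)^2)) (at x)"
proof -
  have "((\<lambda>x. ln x + (3 * w + 2)^2 / (3 * w * (3 * x + 2))) has_real_derivative
      (1 / x - (3 * w + 2)^2 * (9 * w) / (3 * w * (3 * x + 2))^2)) (at x)"
    using assms by (auto intro!: derivative_eq_intros simp: power2_eq_square)
  also have "1 / x - (3 * w + 2)^2 * (9 * w) / (3 * w * (3 * x + 2))^2 =
      (x - w) * (9 * (x * w) - 4) / (w * x * (3 * x + 2)^2)"
    using assms by (simp add: divide_simps) (simp add: power2_eq_square algebra_simps)
  finally show ?thesis .
qed

text \<open>The left-hand side is minimal at \<open>z = w\<close>.\<close>
lemma ln_add_inverse_ge:
  fixes z w :: real
  assumes "2 / 3 \<le> z" "2 / 3 \<le> w"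
  shows "ln z + (3 * w + 2)^2 / (3 * w * (3 * z + 2)) \<ge> ln w + 1 + 2 / (3 * w)"
proof -
  define f where "f x = ln x + (3 * w + 2)^2 / (3 * w * (3 * x + 2))" for x
  define f' where "f' x = (x - w) * (9 * (x * w) - 4) / (w * x * (3 * x + 2)^2)" for x
  have deriv: "(f has_real_derivative f' x) (at x)" if "2 / 3 \<le> x" for x
    unfolding f_def f'_def using that assms by (intro has_real_derivative_ln_add_inverse) auto
  have pos: "9 * (x * w) - 4 \<ge> 0" if "2 / 3 \<le> x" for x
    using mult_mono[OF that assms(2)] that by simp
  have "f w \<le> f z"
  proof (cases "w \<le> z")
    case True
    have "f' x \<ge> 0" if "w \<le> x" for x
      using that assms pos[of x] unfolding f'_def by (intro divide_nonneg_pos) auto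
    then show ?thesis
      using deriv assms by (intro DERIV_nonneg_imp_nondecreasing[OF True]) (meson order_trans)
  next
    case False
    have "f' x \<le> 0" if "2 / 3 \<le> x" "x \<le> w" for x
      using that assms pos[of x] unfolding f'_def
      by (intro divide_nonpos_pos mult_nonpos_nonneg) auto
    moreover have "z \<le> w" using False by simp
    ultimately show ?thesis
      using deriv assms by (intro DERIV_nonpos_imp_nonincreasing[of z w]) (meson order_trans)+
  qed
  moreover have "f w = ln w + 1 + 2 / (3 * w)"
    using assms by (simp add: f_def power2_eq_square add_divide_distrib)
  ultimately show ?thesis by (simp add: f_def)
qed

text \<open>The minimum over \<open>z\<close> lies near \<open>105 / 106\<close> and exceeds the constant by less than
  \<open>4 / 10 ^ 5\<close>; this is what limits the theorem to 1.3999.\<close>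
lemma log_add_inverse_ge:
  fixes z :: real
  assumes "2 / 3 \<le> z"
  shows "log 2 z + 12 / (3 * z + 2) \<ge> 2.39995"
proof -
  have "ln (105 / 106 :: real) = - ln (106 / 105)" by (simp add: ln_div)
  moreover have "ln (106 / 105 :: real) \<le> 9479 / 10 ^ 6"
    using ln_approx_bounds[of "106 / 105" 1] by (simp add: eval_nat_numeral)
  ultimately have "ln (105 / 106 :: real) + 527 / 315 \<ge> 2.39995 * ln 2"
    using ln_2_bounds by simp
  also have "ln (105 / 106) + 527 / 315 \<le> ln z + (277729 / 33390) / (3 * z + 2)"
    using ln_add_inverse_ge[OF assms, of "105 / 106"] by (simp add: power2_eq_square)
  also have "\<dots> \<le> ln z + (12 * ln 2) / (3 * z + 2)"
    using assms ln_2_bounds by (intro add_left_mono divide_right_mono) auto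
  finally show ?thesis by (simp add: log_def field_simps)
qed

lemma sum_ins_group_le:
  "k \<ge> 1 \<Longrightarrow> (\<Sum>i = 2..tJ k. real (ins_group i)) \<le> (real k - 1) * 2 ^ Suc k / 3 + (real k + 1)^2"
proof (induction k rule: dec_induct)
  case base
  then show ?case by simp
next
  case (step k)
  have tJ_le: "1 \<le> tJ k" "tJ k \<le> tJ (Suc k)" using mono_tJ tJ_pos by (auto simp: mono_def)
  have "(\<Sum>i\<in>{tJ k<..tJ (Suc k)}. real (ins_group i)) = (\<Sum>i\<in>{tJ k<..tJ (Suc k)}. real (Suc k))"
    by (intro sum.cong refl arg_cong[of _ _ real] ins_group_eqI) auto
  also have "\<dots> = (real k + 1) * (real (tJ (Suc k)) - real (tJ k))"
    using tJ_le by (simp add: of_nat_diff)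
  also have "\<dots> \<le> (real k + 1) * (2 ^ Suc k / 3 + 2 / 3)"
  proof (rule mult_left_mono)
    have "real (tJ (Suc k)) + real (tJ k) = 2 ^ Suc k"
      using tJ_Suc_add_tJ[of k] by (metis of_nat_add of_nat_numeral of_nat_power)
    then show "real (tJ (Suc k)) - real (tJ k) \<le> 2 ^ Suc k / 3 + 2 / 3"
      using abs_three_mult_tJ_diff_le[of k] by (simp only: abs_le_iff) linarith
  qed simp
  finally have last_group: "(\<Sum>i\<in>{tJ k<..tJ (Suc k)}. real (ins_group i))
      \<le> (real k + 1) * (2 ^ Suc k / 3 + 2 / 3)" .
  have "(\<Sum>i = 2..tJ (Suc k). real (ins_group i)) =
      (\<Sum>i = 2..tJ k. real (ins_group i)) + (\<Sum>i\<in>{tJ k<..tJ (Suc k)}. real (ins_group i))"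
    using tJ_le by (subst sum.union_disjoint[symmetric]) (auto intro!: sum.cong)
  also have "\<dots> \<le> (real k - 1) * 2 ^ Suc k / 3 + (real k + 1)^2 +
      (real k + 1) * (2 ^ Suc k / 3 + 2 / 3)"
    using step.IH last_group by (rule add_mono)
  also have "\<dots> \<le> (real (Suc k) - 1) * 2 ^ Suc (Suc k) / 3 + (real (Suc k) + 1)^2"
    by (simp add: field_simps power2_eq_square)
  finally show ?case .
qed

lemma mult_divide_add_ge:
  fixes N K t :: real
  assumes "N > 0" "K > 0" "t \<ge> 0" "3 * t \<le> K + 1"
  shows "2 * N * K / (N + t) \<ge> 6 * N * K / (3 * N + K) - 1"
proof -
  have "6 * N * K / (3 * N + K) - 6 * N * K / (3 * N + K + 1) =
      6 * N * K / ((3 * N + K) * (3 * N + K + 1))"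
    using assms by (simp add: divide_simps) (simp add: algebra_simps)
  also have "\<dots> \<le> 1"
  proof -
    have "0 \<le> (3 * N - K)^2" by simp
    also have "\<dots> = (3 * N + K)^2 - 12 * N * K" by (simp add: power2_eq_square algebra_simps)
    finally have "6 * N * K \<le> (3 * N + K) * (3 * N + K + 1)"
      using assms by (simp add: power2_eq_square algebra_simps)
    then show ?thesis using assms by simp
  qed
  finally have "6 * N * K / (3 * N + K) - 1 \<le> 6 * N * K / (3 * N + K + 1)" by simp
  also have "\<dots> \<le> 6 * N * K / (3 * (N + t))"
    using assms by (intro divide_left_mono) auto
  also have "\<dots> = 2 * N * K / (N + t)" using assms by (simp add: field_simps)
  finally show ?thesis .
qed

lemma last_group_bound_le:
  fixes N K t k :: real
  assumes "1 \<le> t" "t < N" "N \<le> 3 * t" "\<bar>3 * t - K\<bar> \<le> 1" "K > 0" "k \<ge> 0"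
  shows "(N - t) * (k + 1 - K / (N + t) + k / t) \<le>
    N * (k + 1) - N * (6 * K / (3 * N + K)) - (k - 2) * K / 3 + 2 * k + 1 + (k + 1) / 3"
proof -
  have "(N - t) * (K / (N + t)) = 2 * N * K / (N + t) - K"
    using assms by (simp add: field_simps)
  also have "\<dots> \<ge> 6 * N * K / (3 * N + K) - 1 - K"
    using assms by (intro diff_right_mono mult_divide_add_ge) auto
  finally have saving: "(N - t) * (K / (N + t)) \<ge> N * (6 * K / (3 * N + K)) - 1 - K"
    by (simp add: mult_ac)
  have "(N - t) * (k / t) \<le> 2 * t * (k / t)"
    using assms by (intro mult_right_mono) auto
  also have "\<dots> = 2 * k" using assms(1) by simp
  finally have unbalanced: "(N - t) * (k / t) \<le> 2 * k" .
  have "(N - t) * (k + 1) \<le> (N - K / 3 + 1 / 3) * (k + 1)"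
    using assms by (intro mult_right_mono) auto
  then have "(N - t) * (k + 1) \<le> N * (k + 1) - (k - 2) * K / 3 - K + (k + 1) / 3"
    by (simp add: field_simps)
  moreover have "(N - t) * (k + 1 - K / (N + t) + k / t) =
      (N - t) * (k + 1) - (N - t) * (K / (N + t)) + (N - t) * (k / t)"
    by (simp only: distrib_left right_diff_distrib)
  ultimately show ?thesis using saving unbalanced by linarith
qed

lemma two_power_ins_group_le_three_mult:
  assumes "N \<ge> 2"
  shows "2 ^ ins_group N \<le> 3 * real N"
proof -
  have "Suc (ins_group N - 1) = ins_group N" using ins_group_ge_2[OF assms] by simp
  then have "2 ^ ins_group N \<le> 3 * real (tJ (ins_group N - 1)) + 1"
    using abs_three_mult_tJ_diff_le[of "ins_group N - 1"] by simp
  then show ?thesis using tJ_pred_ins_group_less[OF assms] by linarith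
qed

lemma phase_bound_le_linear:
  assumes N: "N \<ge> 2"
  defines "k \<equiv> ins_group N"
  shows "phase_bound N \<le>
    real N * (real k + 1) - real N * (6 * 2 ^ k / (3 * real N + 2 ^ k)) + 2 * (real k + 1)^2"
proof -
  define t where "t = tJ (k - 1)"
  define K where "K = (2::real) ^ k"
  have "k \<ge> 2" unfolding k_def using N by (rule ins_group_ge_2)
  then have Suc_k: "Suc (k - 1) = k" by simp
  have t: "1 \<le> t" "t < N"
    using tJ_pos tJ_pred_ins_group_less[OF N] by (simp_all add: t_def k_def)
  have "\<bar>3 * real t - K\<bar> \<le> 1"
    using abs_three_mult_tJ_diff_le[of "k - 1"] unfolding Suc_k by (simp add: t_def K_def)
  moreover have "tJ k \<le> 2 * t + 1"
    using tJ_Suc[of "k - 1"] unfolding Suc_k t_def by (auto split: if_splits)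
  then have "N \<le> 3 * t" using le_tJ_ins_group[of N] t(1) by (simp flip: k_def)
  ultimately have last_group:
    "(real N - real t) * (real k + 1 - K / (real N + real t) + real k / real t) \<le>
      real N * (real k + 1) - real N * (6 * K / (3 * real N + K)) - (real k - 2) * K / 3 +
      2 * real k + 1 + (real k + 1) / 3"
    using t by (intro last_group_bound_le) (auto simp: K_def)
  have earlier_groups: "(\<Sum>i = 2..t. real (ins_group i)) \<le> (real k - 2) * K / 3 + (real k)^2"
    using sum_ins_group_le[of "k - 1"] \<open>k \<ge> 2\<close> unfolding Suc_k t_def K_def by simp
  have "phase_bound N = (\<Sum>i = 2..t. real (ins_group i)) +
      (real N - real t) * (real k + 1 - K / (real N + real t) + real k / real t)"
    by (simp only: phase_bound_def mean_binsert_cost_def Let_def of_nat_add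
        flip: k_def t_def K_def)
  also have "\<dots> \<le> real N * (real k + 1) - real N * (6 * K / (3 * real N + K)) +
      ((real k)^2 + 2 * real k + 1 + (real k + 1) / 3)"
    using earlier_groups last_group by linarith
  also have "(real k)^2 + 2 * real k + 1 + (real k + 1) / 3 \<le> 2 * (real k + 1)^2"
    by (simp add: power2_eq_square algebra_simps)
  finally show ?thesis by (simp add: K_def)
qed

lemma phase_bound_le:
  assumes "N \<ge> 1"
  shows "phase_bound N \<le> real N * log 2 (real N) - 0.39995 * real N + 2 * (log 2 (real N) + 3)^2"
proof (cases "N = 1")
  case True
  then show ?thesis by (simp add: phase_bound_eq_0)
next
  case False
  then have N: "N \<ge> 2" using assms by simp
  define k where "k = ins_group N"
  define z where "z = 2 * real N / 2 ^ k"
  note linear = phase_bound_le_linear[OF N, folded k_def]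
  note power_k = two_power_ins_group_le_three_mult[OF N, folded k_def]
  have "real N > 0" using N by simp
  have "2 / 3 \<le> z" using power_k by (simp add: z_def field_simps)
  then have "log 2 z + 12 / (3 * z + 2) \<ge> 2.39995" by (rule log_add_inverse_ge)
  moreover have "log 2 z = 1 + log 2 (real N) - real k"
    using \<open>real N > 0\<close> by (simp add: z_def log_divide log_mult log_nat_power)
  moreover have "12 / (3 * z + 2) = 6 * 2 ^ k / (3 * real N + 2 ^ k)"
    using \<open>real N > 0\<close> by (simp add: z_def divide_simps)
  ultimately have "real k + 1 - 6 * 2 ^ k / (3 * real N + 2 ^ k) \<le> log 2 (real N) - 0.39995"
    by simp
  then have "real N * (real k + 1 - 6 * 2 ^ k / (3 * real N + 2 ^ k)) \<le>
      real N * (log 2 (real N) - 0.39995)"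
    by (intro mult_left_mono) auto
  then have "real N * (real k + 1) - real N * (6 * 2 ^ k / (3 * real N + 2 ^ k)) \<le>
      real N * log 2 (real N) - 0.39995 * real N"
    by (simp add: right_diff_distrib mult.commute)
  moreover have "2 * (real k + 1)^2 \<le> 2 * (log 2 (real N) + 3)^2"
  proof -
    have "(2::real) ^ k \<le> 2^2 * real N" using power_k by simp
    then have "log 2 (2 ^ k) \<le> log 2 (2^2 * real N)"
      using \<open>real N > 0\<close> by (subst log_le_cancel_iff) auto
    then have "real k \<le> 2 + log 2 (real N)"
      using \<open>real N > 0\<close> by (simp only: log_mult log_nat_power) simp
    then show ?thesis by (intro mult_left_mono power_mono) auto
  qed
  ultimately show ?thesis using linear by linarith
qed

lemma log_half_le:
  assumes "n \<ge> 2"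
  shows "log 2 (real (n div 2)) \<le> log 2 (real n) - 1"
proof -
  have "log 2 (real (n div 2)) \<le> log 2 (real n / 2)"
    using assms by (subst log_le_cancel_iff) auto
  then show ?thesis using assms by (simp add: log_divide)
qed

lemma mult_log_half_Suc_le:
  assumes "n \<ge> 2"
  defines "N \<equiv> (n + 1) div 2"
  shows "real N * log 2 (real N) \<le> real N * (log 2 (real n) - 1) + 2"
proof -
  have "2 * real N \<le> real n + 1" by (auto simp: N_def)
  moreover have "real n / 2 * (1 + 1 / real n) = (real n + 1) / 2"
    using assms(1) by (simp add: field_simps)
  ultimately have N: "0 < real N" "real N \<le> real n" "real N \<le> real n / 2 * (1 + 1 / real n)"
    using assms(1) by (auto simp: N_def)
  have "1 + 1 / real n > 0" using assms(1) by (simp add: add_pos_pos)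
  have "log 2 (real N) \<le> log 2 (real n / 2 * (1 + 1 / real n))"
    using N \<open>1 + 1 / real n > 0\<close> assms(1) by (subst log_le_cancel_iff) auto
  also have "\<dots> = log 2 (real n) - 1 + log 2 (1 + 1 / real n)"
    using \<open>1 + 1 / real n > 0\<close> assms(1) by (simp add: log_mult log_divide)
  also have "log 2 (1 + 1 / real n) \<le> (1 / real n) / (1 / 2)"
    unfolding log_def using ln_2_bounds by (intro frac_le ln_add_one_self_le_self) auto
  finally have "real N * log 2 (real N) \<le> real N * (log 2 (real n) - 1 + 2 / real n)"
    by (intro mult_left_mono) auto
  also have "\<dots> = real N * (log 2 (real n) - 1) + real N * (2 / real n)" by (rule distrib_left)
  also have "real N * (2 / real n) \<le> 2" using N assms(1) by (simp add: field_simps)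
  finally show ?thesis by simp
qed

lemma avg_bound_le:
  "n \<ge> 1 \<Longrightarrow> avg_bound n \<le> real n * log 2 (real n) - 1.39995 * real n + 20 * (1 + log 2 (real n))^3"
proof (induction n rule: less_induct)
  case (less n)
  show ?case
  proof (cases "n = 1")
    case True
    then show ?thesis by (simp add: avg_bound.simps)
  next
    case False
    then have n: "n \<ge> 2" using less.prems by simp
    define m N L where "m = n div 2" and "N = (n + 1) div 2" and "L = log 2 (real n)"
    have mN: "m \<ge> 1" "N \<ge> 1" "m < n" "real m + real N = real n"
      using n by (auto simp: m_def N_def simp flip: of_nat_add)
    have "L \<ge> 1" using n by (simp add: L_def le_log_iff)
    have log_m: "log 2 (real m) \<le> L - 1" unfolding m_def L_def using n by (rule log_half_le)
    have "avg_bound n = real m + avg_bound m + phase_bound N"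
      using n by (subst avg_bound.simps) (simp add: m_def N_def)
    also have "avg_bound m \<le> real m * (L - 1) - 1.39995 * real m + 20 * L^3"
    proof -
      have "real m * log 2 (real m) \<le> real m * (L - 1)" using log_m by (intro mult_left_mono) auto
      moreover have "(1 + log 2 (real m))^3 \<le> L^3" using log_m mN by (intro power_mono) auto
      ultimately show ?thesis using less.IH[of m] mN by linarith
    qed
    also have "phase_bound N \<le> real N * (L - 1) + 2 - 0.39995 * real N + 2 * (L + 3)^2"
    proof -
      have "real N * log 2 (real N) \<le> real N * (L - 1) + 2"
        unfolding N_def L_def using n by (rule mult_log_half_Suc_le)
      moreover have "0 \<le> log 2 (real N)" "log 2 (real N) \<le> L" using mN by (auto simp: L_def)
      then have "(log 2 (real N) + 3)^2 \<le> (L + 3)^2" by (intro power_mono) auto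
      ultimately show ?thesis using phase_bound_le[OF \<open>N \<ge> 1\<close>] by linarith
    qed
    also have "real m + (real m * (L - 1) - 1.39995 * real m + 20 * L^3) +
        (real N * (L - 1) + 2 - 0.39995 * real N + 2 * (L + 3)^2) =
        (real m + real N) * L - 1.39995 * (real m + real N) + (20 * L^3 + 2 + 2 * (L + 3)^2)"
      by (simp add: algebra_simps)
    also have "20 * L^3 + 2 + 2 * (L + 3)^2 = 20 * (1 + L)^3 - (58 * L^2 + 48 * L)"
      by algebra
    also have "\<dots> \<le> 20 * (1 + L)^3" using \<open>L \<ge> 1\<close> zero_le_power2[of L] by linarith
    finally show ?thesis by (simp add: mN L_def)
  qed
qed

theorem theorem6:
  "\<exists>(c :: nat \<Rightarrow> real) (g :: nat \<Rightarrow> real).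
     (\<forall>n. c n \<ge> 1.3999) \<and>
     g \<in> O(\<lambda>n. log 2 (real n)) \<and>
     (\<forall>n. avg_comparisons_MI n = real n * log 2 (real n) - c n * real n + g n)"
proof -
  define c where "c n = max 1.3999 (log 2 (real n) - avg_comparisons_MI n / real n)" for n
  define g where "g n = avg_comparisons_MI n - real n * log 2 (real n) + c n * real n" for n
  have "eventually (\<lambda>n. 20 * (1 + log 2 (real n))^3 \<le> 0.00005 * real n) at_top"
    by real_asymp
  then have "eventually (\<lambda>n. g n = 0) at_top"
    using eventually_ge_at_top[of 1]
  proof eventually_elim
    case (elim n)
    have "avg_comparisons_MI n \<le> real n * log 2 (real n) - 1.3999 * real n"
      using avg_comparisons_MI_le[of n] avg_bound_le[OF elim(2)] elim(1) by simp
    then have "c n = log 2 (real n) - avg_comparisons_MI n / real n"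
      using elim(2) by (simp add: c_def field_simps)
    then show ?case using elim(2) by (simp add: g_def field_simps)
  qed
  then have "g \<in> O(\<lambda>n. log 2 (real n))"
    by (intro bigoI[of _ 0]) (auto elim: eventually_mono)
  moreover have "c n \<ge> 1.3999" for n by (simp add: c_def)
  moreover have "avg_comparisons_MI n = real n * log 2 (real n) - c n * real n + g n" for n
    by (simp add: g_def)
  ultimately show ?thesis by blast
qed

end
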